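(* For Lebesgue-almost every triangle $\Delta$ (in the space of triangles up to similarity, parametrized by two of its angles $(\alpha,\beta)$ ranging over $\{\alpha>0,\beta>0,\alpha+\beta<\pi\}$ with Lebesgue measure) the following holds: for every $\epsilon>0$ there is a constant $C>0$ such that for all $n\ge1$, $$\mathrm{Per}_n(\Delta)<C\,e^{n^{\sqrt{3}-1+\epsilon}}.$$
   Context: For the billiard in a triangle $\Delta$, the combinatorial type of a periodic billiard orbit is the (cyclic) sequence of sides of $\Delta$ it hits. The length of a periodic orbit is its number of reflections per period. $\mathrm{Per}_n(\Delta)$ denotes the number of distinct combinatorial types of periodic billiard orbits in $\Delta$ of length at most $n$. *)

theory Defs
  imports "HOL-Analysis.Analysis"
begin

text \<open>The triangle with angles alpha at vertex 0 and beta at vertex 1,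
  normalised (up to similarity) so that vertex 0 is the origin and vertex 1 is 1;
  vertex 2 is determined by the law of sines.  Side i is the open segment from
  vertex i to vertex (i+1) mod 3.\<close>
definition tri_vertex :: "real \<Rightarrow> real \<Rightarrow> nat \<Rightarrow> complex" where
  "tri_vertex \<alpha> \<beta> i =
     (if i mod 3 = 0 then 0
      else if i mod 3 = 1 then 1
      else complex_of_real (sin \<beta> / sin (\<alpha> + \<beta>)) * cis \<alpha>)"

definition line_reflect :: "complex \<Rightarrow> complex \<Rightarrow> complex" where
  "line_reflect u d = scaleR (2 * ((d \<bullet> u) / (u \<bullet> u))) u - d"

definition side :: "(nat \<Rightarrow> complex) \<Rightarrow> nat \<Rightarrow> complex set" where
  "side V i = open_segment (V i) (V ((i + 1) mod 3))"

definition periodic_billiard_orbit ::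
    "(nat \<Rightarrow> complex) \<Rightarrow> nat \<Rightarrow> (nat \<Rightarrow> complex) \<Rightarrow> (nat \<Rightarrow> nat) \<Rightarrow> bool" where
  "periodic_billiard_orbit V k p s \<longleftrightarrow>
     k \<ge> 1 \<and>
     (\<forall>j. p (j + k) = p j \<and> s (j + k) = s j) \<and>
     (\<forall>m. 0 < m \<and> m < k \<longrightarrow> (\<exists>j. p (j + m) \<noteq> p j)) \<and>
     (\<forall>j. s j < 3 \<and> p j \<in> side V (s j)) \<and>
     (\<forall>j. s (Suc j) \<noteq> s j) \<and>
     (\<forall>j. \<exists>t>0. p (j + 2) - p (j + 1) =
          scaleR t (line_reflect (V ((s (j + 1) + 1) mod 3) - V (s (j + 1)))
                                 (p (j + 1) - p j)))"

definition cyclic_class :: "nat list \<Rightarrow> nat list set" where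
  "cyclic_class w = {rotate j w | j. True}"

definition Per :: "nat \<Rightarrow> (nat \<Rightarrow> complex) \<Rightarrow> nat" where
  "Per n V = card {cyclic_class (map s [0..<k]) | k p s.
                     k \<le> n \<and> periodic_billiard_orbit V k p s}"

end

theory Submission
  imports Defs "HOL-Computational_Algebra.Fundamental_Theorem_Algebra" "HOL-Real_Asymp.Real_Asymp"
begin

text \<open>A billiard orbit unfolds to a straight line through reflected copies of the triangle, and its
  next side is decided by the side of the line on which the new vertex of the current copy lies.
  Two orbits whose initial positions and directions are \<open>\<delta>\<close>-close can therefore part only when the
  new vertex is close to both lines.

  The cross product spanned by three unfolded vertices is, up to a harmless factor, a trigonometric
  polynomial in the two angles with integer coefficients and of degree linear in the word length
  \<open>m\<close>. Removing small discs around the zeros, first in one variable and then in the other, bounds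
  the measure of the set on which such a polynomial is nonzero but tiny; a union over the
  exponentially many words and the Borel-Cantelli lemma show that for almost every triangle and all
  large \<open>m\<close>, three vertices of an unfolding of length \<open>m\<close> are collinear or at least
  \<open>exp (- O(m^(5/2)))\<close> away from it.

  Hence, for \<open>\<delta>\<close> slightly smaller than this, the vertices that a line nearly meets within a block of
  \<open>m\<close> steps lie on one common line, which the orbit crosses at most once: a block needs only
  polynomially many codes. An orbit of length \<open>n\<close> is thus determined by a \<open>\<delta>\<close>-cell and \<open>n / m\<close> block
  codes, and \<open>m = n^(2/7)\<close> balances the two contributions to \<open>exp (O(n^(5/7) ln n))\<close>, where
  \<open>5 / 7 < 0.73 < sqrt 3 - 1\<close>.\<close>

section \<open>Integer polynomials in two unimodular variables\<close>

text \<open>Up to \<open>pi / 3\<close> the cosine is at least 1/2 and the mean value theorem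
  applies; beyond it \<open>sin u\<close> is at least \<open>sqrt 3 / 2\<close>, which exceeds
  \<open>pi / 4\<close>.\<close>

lemma sin_ge_half:
  fixes u :: real
  assumes "0 \<le> u" "u \<le> pi / 2"
  shows "u / 2 \<le> sin u"
proof (cases "u \<le> pi / 3")
  case True
  show ?thesis
  proof (cases "u = 0")
    case False
    then have "0 < u" using assms by simp
    then obtain z where z: "z > 0" "z < u" "sin u - sin 0 = (u - 0) * cos z"
      using MVT2[of 0 u sin cos] by (auto intro: DERIV_sin)
    have "cos (pi / 3) \<le> cos z"
      using z True pi_gt_zero by (intro cos_monotone_0_pi_le) auto
    then have "u * (1 / 2) \<le> u * cos z"
      using \<open>0 < u\<close> by (intro mult_left_mono) (auto simp: cos_60)
    then show ?thesis using z by simp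
  qed auto
next
  case False
  have "sin (pi / 3) \<le> sin u"
    using False assms by (intro sin_monotone_2pi_le) auto
  moreover have "sqrt 3 / 2 = sin (pi / 3)" by (simp add: sin_60)
  moreover have "(1.7::real) \<le> sqrt 3" by (rule real_le_rsqrt) (simp add: power2_eq_square)
  moreover have "pi \<le> 3.2" using pi_approx by simp
  ultimately show ?thesis using assms by simp
qed

text \<open>A chord of the unit circle is twice the sine of half the angular distance, and on a half
  circle that half distance stays within \<open>{0..pi / 2}\<close>.\<close>

lemma dist_cis_ge:
  assumes "x \<in> {0..pi}" "y \<in> {0..pi}"
  shows "\<bar>x - y\<bar> / 2 \<le> dist (cis x) (cis y)"
proof -
  have *: "(dist (cis x) (cis y))\<^sup>2 = (2 * sin (\<bar>x - y\<bar> / 2))\<^sup>2" for x y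
  proof -
    have "(dist (cis x) (cis y))\<^sup>2 = (cos x - cos y)\<^sup>2 + (sin x - sin y)\<^sup>2"
      by (simp add: dist_norm cmod_def)
    also have "\<dots> = 2 - 2 * cos (x - y)"
      using sin_cos_squared_add[of x] sin_cos_squared_add[of y]
      by (simp add: cos_diff power2_eq_square algebra_simps)
    also have "cos (x - y) = cos (2 * (\<bar>x - y\<bar> / 2))" by (simp add: abs_if) (metis cos_minus minus_diff_eq)
    also have "\<dots> = 1 - 2 * (sin (\<bar>x - y\<bar> / 2))\<^sup>2"
      by (subst cos_double) (simp add: cos_squared_eq)
    finally show ?thesis by (simp add: power_mult_distrib)
  qed
  have r: "0 \<le> \<bar>x - y\<bar> / 2" "\<bar>x - y\<bar> / 2 \<le> pi / 2" using assms by auto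
  have s: "\<bar>x - y\<bar> / 2 / 2 \<le> sin (\<bar>x - y\<bar> / 2)" using sin_ge_half[OF r] .
  have "dist (cis x) (cis y) = 2 * sin (\<bar>x - y\<bar> / 2)"
  proof (rule power2_eq_imp_eq[OF *])
    show "0 \<le> 2 * sin (\<bar>x - y\<bar> / 2)" using s r by linarith
  qed simp
  then show ?thesis using s by simp
qed

lemma borel_closed_Collect_open:
  assumes "closed A" "open {t. P t}"
  shows "{t \<in> A. P t} \<in> sets borel"
proof -
  have "A \<inter> {t. P t} \<in> sets borel" using assms by (intro sets.Int) auto
  moreover have "A \<inter> {t. P t} = {t \<in> A. P t}" by blast
  ultimately show ?thesis by simp
qed

text \<open>The centre may lie off the circle, so the set is compared with one of its own points
  \<open>t0\<close>: chords between members are shorter than \<open>2 * \<rho>\<close>, hence all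
  members lie within \<open>4 * \<rho>\<close> of \<open>t0\<close>.\<close>

lemma emeasure_cis_near_le:
  assumes "0 < \<rho>"
  shows "emeasure lborel {t \<in> {0..pi}. dist (cis t) \<zeta> < \<rho>} \<le> ennreal (8 * \<rho>)"
proof (cases "{t \<in> {0..pi}. dist (cis t) \<zeta> < \<rho>} = {}")
  case True
  then show ?thesis by (simp only: emeasure_empty zero_le)
next
  case False
  then obtain t0 where t0: "t0 \<in> {0..pi}" "dist (cis t0) \<zeta> < \<rho>" by auto
  have "{t \<in> {0..pi}. dist (cis t) \<zeta> < \<rho>} \<subseteq> {t0 - 4 * \<rho> .. t0 + 4 * \<rho>}"
  proof
    fix t assume t: "t \<in> {t \<in> {0..pi}. dist (cis t) \<zeta> < \<rho>}"
    have "\<bar>t - t0\<bar> / 2 \<le> dist (cis t) (cis t0)" using t t0 by (intro dist_cis_ge) auto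
    also have "\<dots> < 2 * \<rho>" using t t0 dist_triangle2[of "cis t" "cis t0" \<zeta>] by simp
    finally have "\<bar>t - t0\<bar> < 4 * \<rho>" by simp
    then show "t \<in> {t0 - 4 * \<rho> .. t0 + 4 * \<rho>}" by (simp only: atLeastAtMost_iff) linarith
  qed
  then have "emeasure lborel {t \<in> {0..pi}. dist (cis t) \<zeta> < \<rho>} \<le> emeasure lborel {t0 - 4 * \<rho> .. t0 + 4 * \<rho>}"
    by (rule emeasure_mono) simp
  also have "\<dots> = ennreal (8 * \<rho>)" using assms by simp
  finally show ?thesis .
qed

text \<open>In the factorisation into linear factors, a point at distance at least
  \<open>\<rho>\<close> from every root makes each factor at least \<open>\<rho>\<close>. Small
  values therefore occur only on the arcs near the roots, at most \<open>M\<close> in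
  number.\<close>

lemma emeasure_poly_cis_small_le:
  fixes q :: "complex poly"
  assumes deg: "degree q \<le> M" and L: "0 < L" "L \<le> norm (lead_coeff q)" and \<rho>: "0 < \<rho>" "\<rho> \<le> 1"
  shows "emeasure lborel {t \<in> {0..pi}. norm (poly q (cis t)) < L * \<rho> ^ M} \<le> ennreal (8 * real M * \<rho>)"
proof -
  obtain root where root: "smult (lead_coeff q) (\<Prod>i<degree q. [:-root i, 1:]) = q"
    by (rule complex_poly_decompose')
  have pq: "poly q z = lead_coeff q * (\<Prod>i<degree q. (z - root i))" for z
    by (subst root[symmetric]) (simp add: poly_prod)
  have "{t \<in> {0..pi}. norm (poly q (cis t)) < L * \<rho> ^ M} \<subseteq>
      (\<Union>i<degree q. {t \<in> {0..pi}. dist (cis t) (root i) < \<rho>})"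
  proof
    fix t assume t: "t \<in> {t \<in> {0..pi}. norm (poly q (cis t)) < L * \<rho> ^ M}"
    show "t \<in> (\<Union>i<degree q. {t \<in> {0..pi}. dist (cis t) (root i) < \<rho>})"
    proof (rule ccontr)
      assume "\<not> ?thesis"
      then have far: "\<rho> \<le> norm (cis t - root i)" if "i < degree q" for i
        using t that by (auto simp: dist_norm not_less)
      have "\<rho> ^ M \<le> \<rho> ^ degree q" using deg \<rho> by (intro power_decreasing) auto
      also have "\<dots> = (\<Prod>i<degree q. \<rho>)" by simp
      also have "\<dots> \<le> (\<Prod>i<degree q. norm (cis t - root i))"
        using far \<rho> by (intro prod_mono) auto
      finally have "L * \<rho> ^ M \<le> norm (lead_coeff q) * (\<Prod>i<degree q. norm (cis t - root i))"
        using L \<rho> by (intro mult_mono) auto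
      also have "\<dots> = norm (poly q (cis t))" by (simp add: pq norm_mult prod_norm)
      finally show False using t by simp
    qed
  qed
  moreover have meas: "{t \<in> {0..pi}. dist (cis t) (root i) < \<rho>} \<in> sets lborel" for i
    unfolding cis_conv_exp sets_lborel
    by (intro borel_closed_Collect_open open_Collect_less continuous_intros closed_atLeastAtMost)
  ultimately have "emeasure lborel {t \<in> {0..pi}. norm (poly q (cis t)) < L * \<rho> ^ M} \<le>
     emeasure lborel (\<Union>i<degree q. {t \<in> {0..pi}. dist (cis t) (root i) < \<rho>})"
    by (intro emeasure_mono) auto
  also have "\<dots> \<le> (\<Sum>i<degree q. emeasure lborel {t \<in> {0..pi}. dist (cis t) (root i) < \<rho>})"
    using meas by (intro emeasure_subadditive_finite) auto
  also have "\<dots> \<le> (\<Sum>i<degree q. ennreal (8 * \<rho>))"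
    by (intro sum_mono emeasure_cis_near_le \<rho>)
  also have "\<dots> = ennreal (8 * degree q * \<rho>)"
    using \<rho> by (simp add: ennreal_of_nat_eq_real_of_nat ennreal_mult'[symmetric] mult_ac)
  also have "\<dots> \<le> ennreal (8 * real M * \<rho>)"
    using deg \<rho> by (intro ennreal_leI mult_right_mono) auto
  finally show ?thesis .
qed

lemma norm_Ints_ge_1:
  fixes z :: complex
  assumes "z \<in> \<int>" "z \<noteq> 0"
  shows "1 \<le> norm z"
proof -
  obtain k where k: "z = of_int k" using assms(1) by (auto elim: Ints_cases)
  then have "1 \<le> \<bar>k\<bar>" using assms(2) by auto
  then have "1 \<le> \<bar>real_of_int k\<bar>" by linarith
  then show ?thesis by (simp add: k)
qed

section \<open>Small values of an integer polynomial in two variables\<close>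

text \<open>The outer polynomial variable stands for \<open>cis (snd x)\<close>, the variable of the
  coefficients for \<open>cis (fst x)\<close>.\<close>

definition eval2 :: "complex poly poly \<Rightarrow> real \<times> real \<Rightarrow> complex" where
  "eval2 P x = poly (poly P [:cis (snd x):]) (cis (fst x))"

definition int_poly2 :: "nat \<Rightarrow> complex poly poly \<Rightarrow> bool" where
  "int_poly2 M P \<longleftrightarrow> degree P \<le> M \<and> (\<forall>i. degree (coeff P i) \<le> M) \<and> (\<forall>i j. coeff (coeff P i) j \<in> \<int>)"

text \<open>Specialising the coefficients first yields the one-variable polynomial that governs a
  slice of constant \<open>fst x\<close>.\<close>

lemma poly_poly_const: "poly (poly P [:w:]) z = poly (map_poly (\<lambda>c. poly c z) P) w"
  by (induction P) (auto simp: map_poly_pCons)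

lemma continuous_eval2: "continuous_on UNIV (eval2 P)"
proof -
  have c: "continuous_on UNIV (\<lambda>x::real\<times>real. cis (fst x))" "continuous_on UNIV (\<lambda>x::real\<times>real. cis (snd x))"
    unfolding cis_conv_exp by (intro continuous_intros)+
  show ?thesis
  proof (induction P)
    case 0
    then show ?case by (simp add: eval2_def[abs_def])
  next
    case (pCons a P)
    have "eval2 (pCons a P) = (\<lambda>x. poly a (cis (fst x)) + cis (snd x) * eval2 P x)"
      by (auto simp: eval2_def)
    then show ?case using pCons.IH by (auto intro!: continuous_intros c)
  qed
qed

text \<open>The leading coefficient \<open>g\<close> of \<open>P\<close> is itself a polynomial
  whose leading coefficient is a nonzero integer, hence of norm at least 1. So \<open>g\<close>
  falls below \<open>\<rho> ^ M\<close> only on the small set \<open>E1\<close>, over which slices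
  are bounded trivially by \<open>pi\<close>. Over any other \<open>a\<close> the slice polynomial
  has leading coefficient at least \<open>\<rho> ^ M\<close>, and the one-variable bound costs a
  second factor \<open>\<rho> ^ M\<close>. Fubini combines the two.\<close>

lemma emeasure_eval2_small_le:
  assumes P: "int_poly2 M P" "P \<noteq> 0" and \<rho>: "0 < \<rho>" "\<rho> \<le> 1"
  shows "emeasure lborel {x \<in> {0..pi} \<times> {0..pi}. norm (eval2 P x) < \<rho> ^ (2 * M)} \<le> ennreal (16 * pi * real M * \<rho>)"
    (is "emeasure _ ?E \<le> _")
proof -
  define g where "g = lead_coeff P"
  have g: "degree g \<le> M" "g \<noteq> 0" using P by (auto simp: g_def int_poly2_def)
  have "lead_coeff g \<in> \<int>" "lead_coeff g \<noteq> 0" using P by (auto simp: g_def int_poly2_def)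
  then have lg: "1 \<le> norm (lead_coeff g)" by (rule norm_Ints_ge_1)
  define E1 where "E1 = {t \<in> {0..pi}. norm (poly g (cis t)) < 1 * \<rho> ^ M}"
  have E1: "emeasure lborel E1 \<le> ennreal (8 * real M * \<rho>)"
    unfolding E1_def using g lg \<rho> by (intro emeasure_poly_cis_small_le) auto
  have E1m: "E1 \<in> sets borel"
    unfolding E1_def cis_conv_exp
    by (intro borel_closed_Collect_open open_Collect_less continuous_intros closed_atLeastAtMost)
  have slice: "emeasure lborel (Pair a -` ?E) \<le>
      ennreal pi * indicator E1 a + ennreal (8 * real M * \<rho>) * indicator {0..pi} a" for a
  proof (cases "a \<in> {0..pi}")
    case False
    then have "Pair a -` ?E = {}" by auto
    then show ?thesis by (simp only: emeasure_empty zero_le)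
  next
    case True
    show ?thesis
    proof (cases "a \<in> E1")
      case True
      have "emeasure lborel (Pair a -` ?E) \<le> emeasure lborel {0..pi}"
        by (rule emeasure_mono) auto
      then show ?thesis using True by (simp add: add_increasing2)
    next
      case False
      define Q where "Q = map_poly (\<lambda>c. poly c (cis a)) P"
      have big: "\<rho> ^ M \<le> norm (poly g (cis a))" using False True by (auto simp: E1_def)
      then have "poly g (cis a) \<noteq> 0" using \<rho> by (metis norm_zero not_le zero_less_power)
      then have dQ: "degree Q = degree P" unfolding Q_def g_def by (intro map_poly_degree_eq) auto
      have lQ: "lead_coeff Q = poly g (cis a)" by (simp add: dQ) (simp add: Q_def g_def coeff_map_poly)
      have sub: "Pair a -` ?E \<subseteq> {t \<in> {0..pi}. norm (poly Q (cis t)) < \<rho> ^ M * \<rho> ^ M}"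
        by (auto simp: eval2_def poly_poly_const Q_def power_add mult_2)
      have bound: "emeasure lborel {t \<in> {0..pi}. norm (poly Q (cis t)) < \<rho> ^ M * \<rho> ^ M} \<le> ennreal (8 * real M * \<rho>)"
        using P dQ lQ big \<rho> by (intro emeasure_poly_cis_small_le) (auto simp: int_poly2_def)
      have "{t \<in> {0..pi}. norm (poly Q (cis t)) < \<rho> ^ M * \<rho> ^ M} \<in> sets lborel"
        unfolding cis_conv_exp sets_lborel
        by (intro borel_closed_Collect_open open_Collect_less continuous_intros closed_atLeastAtMost)
      then have "emeasure lborel (Pair a -` ?E) \<le> ennreal (8 * real M * \<rho>)"
        using order_trans[OF emeasure_mono[OF sub] bound] by blast
      then show ?thesis using False True by simp
    qed
  qed
  have Em: "?E \<in> sets borel"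
    by (intro borel_closed_Collect_open open_Collect_less continuous_intros continuous_eval2
        closed_Times closed_atLeastAtMost)
  have "emeasure lborel ?E = emeasure (lborel \<Otimes>\<^sub>M lborel) ?E" by (simp add: lborel_prod)
  also have "\<dots> = (\<integral>\<^sup>+a. emeasure lborel (Pair a -` ?E) \<partial>lborel)"
    by (rule lborel.emeasure_pair_measure_alt) (simp only: lborel_prod sets_lborel Em)
  also have "\<dots> \<le> (\<integral>\<^sup>+a. ennreal pi * indicator E1 a + ennreal (8 * real M * \<rho>) * indicator {0..pi} a \<partial>lborel)"
    by (intro nn_integral_mono slice)
  also have "\<dots> = ennreal pi * emeasure lborel E1 + ennreal (8 * real M * \<rho>) * ennreal pi"
    using E1m by (subst nn_integral_add) (auto simp: nn_integral_cmult)
  also have "\<dots> \<le> ennreal pi * ennreal (8 * real M * \<rho>) + ennreal (8 * real M * \<rho>) * ennreal pi"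
    by (intro add_mono mult_left_mono E1) auto
  also have "\<dots> = ennreal (16 * pi * real M * \<rho>)"
    using \<rho> by (simp add: ennreal_mult'[symmetric] ennreal_plus[symmetric] algebra_simps del: ennreal_plus)
  finally show ?thesis .
qed

lemma int_poly2_add: "int_poly2 M P \<Longrightarrow> int_poly2 M Q \<Longrightarrow> int_poly2 M (P + Q)"
  by (auto simp: int_poly2_def intro: degree_add_le)

lemma int_poly2_uminus: "int_poly2 M P \<Longrightarrow> int_poly2 M (- P)"
  by (auto simp: int_poly2_def)

lemma int_poly2_mult:
  assumes "int_poly2 M P" "int_poly2 N Q"
  shows "int_poly2 (M + N) (P * Q)"
  unfolding int_poly2_def
proof (intro conjI allI)
  show "degree (P * Q) \<le> M + N"
    using assms degree_mult_le[of P Q] by (auto simp: int_poly2_def)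
  show "degree (coeff (P * Q) i) \<le> M + N" for i
    unfolding coeff_mult using assms
    by (intro degree_sum_le) (auto simp: int_poly2_def intro!: order.trans[OF degree_mult_le] add_mono)
  show "coeff (coeff (P * Q) i) j \<in> \<int>" for i j
    unfolding coeff_mult coeff_sum using assms
    by (intro Ints_sum) (auto simp: int_poly2_def coeff_mult intro!: Ints_sum)
qed

lemma int_poly2_monom: "i \<le> M \<Longrightarrow> j \<le> M \<Longrightarrow> int_poly2 M (monom (monom 1 j) i)"
  by (auto simp: int_poly2_def degree_monom_eq)

section \<open>Trigonometric polynomials in the two angles\<close>

definition tri_params :: "(real \<times> real) set" where
  "tri_params = {x. 0 < fst x \<and> 0 < snd x \<and> fst x + snd x < pi}"

text \<open>The factor \<open>cis (N * (fst x + snd x))\<close> turns a Laurent polynomial of degree \<open>N\<close> in each of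
  \<open>cis (fst x)\<close> and \<open>cis (snd x)\<close> into a polynomial.\<close>
definition int_trig :: "nat \<Rightarrow> (real \<times> real \<Rightarrow> complex) \<Rightarrow> bool" where
  "int_trig N F \<longleftrightarrow> (\<exists>P. int_poly2 (2 * N) P \<and>
     (\<forall>x\<in>tri_params. F x * cis (N * (fst x + snd x)) = eval2 P x))"

lemma int_trig_add:
  assumes "int_trig N F" "int_trig N G"
  shows "int_trig N (\<lambda>x. F x + G x)"
proof -
  obtain P Q where "int_poly2 (2 * N) P" "int_poly2 (2 * N) Q"
    "\<forall>x\<in>tri_params. F x * cis (N * (fst x + snd x)) = eval2 P x"
    "\<forall>x\<in>tri_params. G x * cis (N * (fst x + snd x)) = eval2 Q x"
    using assms unfolding int_trig_def by blast
  then have "int_poly2 (2 * N) (P + Q) \<and>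
     (\<forall>x\<in>tri_params. (F x + G x) * cis (N * (fst x + snd x)) = eval2 (P + Q) x)"
    by (simp add: int_poly2_add eval2_def distrib_right)
  then show ?thesis unfolding int_trig_def by blast
qed

lemma int_trig_uminus:
  assumes "int_trig N F"
  shows "int_trig N (\<lambda>x. - F x)"
proof -
  obtain P where "int_poly2 (2 * N) P" "\<forall>x\<in>tri_params. F x * cis (N * (fst x + snd x)) = eval2 P x"
    using assms unfolding int_trig_def by blast
  then have "int_poly2 (2 * N) (- P) \<and>
     (\<forall>x\<in>tri_params. (- F x) * cis (N * (fst x + snd x)) = eval2 (- P) x)"
    by (simp add: int_poly2_uminus eval2_def)
  then show ?thesis unfolding int_trig_def by blast
qed

lemma int_trig_diff: "int_trig N F \<Longrightarrow> int_trig N G \<Longrightarrow> int_trig N (\<lambda>x. F x - G x)"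
  using int_trig_add[OF _ int_trig_uminus, of N F G] by simp

lemma int_trig_mult:
  assumes "int_trig N F" "int_trig M G"
  shows "int_trig (N + M) (\<lambda>x. F x * G x)"
proof -
  obtain P Q where PQ: "int_poly2 (2 * N) P" "int_poly2 (2 * M) Q"
    "\<forall>x\<in>tri_params. F x * cis (N * (fst x + snd x)) = eval2 P x"
    "\<forall>x\<in>tri_params. G x * cis (M * (fst x + snd x)) = eval2 Q x"
    using assms unfolding int_trig_def by blast
  have "F x * G x * cis (real (N + M) * (fst x + snd x)) = eval2 (P * Q) x" if "x \<in> tri_params" for x
  proof -
    have "F x * G x * cis (real (N + M) * (fst x + snd x)) =
       (F x * cis (N * (fst x + snd x))) * (G x * cis (M * (fst x + snd x)))"
      by (simp add: distrib_right cis_mult[symmetric] mult_ac)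
    also have "\<dots> = eval2 P x * eval2 Q x" using PQ(3,4) that by (simp only:)
    finally show ?thesis by (simp add: eval2_def)
  qed
  then show ?thesis unfolding int_trig_def
    using int_poly2_mult[OF PQ(1,2)] by (intro exI[of _ "P * Q"]) (simp add: distrib_left)
qed

lemma int_trig_cis:
  fixes a b :: int
  assumes "\<bar>a\<bar> \<le> int N" "\<bar>b\<bar> \<le> int N"
  shows "int_trig N (\<lambda>x. cis (of_int a * fst x + of_int b * snd x))"
proof -
  define i j where "i = nat (a + int N)" and "j = nat (b + int N)"
  have ij: "i \<le> 2 * N" "j \<le> 2 * N" "int i = a + int N" "int j = b + int N"
    using assms by (auto simp: i_def j_def)
  have a: "of_int a = real i - real N" and b: "of_int b = real j - real N"
    using ij(3,4) by linarith+
  define P :: "complex poly poly" where "P = monom (monom 1 i) j"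
  have "int_poly2 (2 * N) P" unfolding P_def using ij by (intro int_poly2_monom) auto
  moreover have "cis (of_int a * fst x + of_int b * snd x) * cis (N * (fst x + snd x)) = eval2 P x" for x :: "real \<times> real"
  proof -
    have "eval2 P x = cis (fst x) ^ i * cis (snd x) ^ j"
      by (simp add: P_def eval2_def poly_monom mult.commute poly_power)
    also have "\<dots> = cis (real i * fst x + real j * snd x)"
      by (simp only: Complex.DeMoivre cis_mult)
    also have "\<dots> = cis ((of_int a * fst x + of_int b * snd x) + (N * (fst x + snd x)))"
      unfolding a b by (simp add: algebra_simps)
    finally show ?thesis by (simp only: cis_mult)
  qed
  ultimately show ?thesis unfolding int_trig_def by blast
qed

lemma int_trig_one: "int_trig N (\<lambda>x. 1)"
  using int_trig_cis[of 0 N 0] by simp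

lemma int_trig_zero: "int_trig N (\<lambda>x. 0)"
  using int_trig_diff[OF int_trig_one int_trig_one] by simp

lemma int_trig_mono: "int_trig N F \<Longrightarrow> N \<le> M \<Longrightarrow> int_trig M F"
  using int_trig_mult[OF _ int_trig_one, of N F "M - N"] by simp

lemma tri_params_subset: "tri_params \<subseteq> {0..pi} \<times> {0..pi}"
  by (auto simp: tri_params_def)

lemma open_tri_params: "open tri_params"
proof -
  have "tri_params = {x. 0 < fst x} \<inter> {x. 0 < snd x} \<inter> {x. fst x + snd x < pi}"
    by (auto simp: tri_params_def)
  also have "open \<dots>" by (intro open_Int open_Collect_less continuous_intros)
  finally show ?thesis .
qed

text \<open>The normalising factor is unimodular, so \<open>F\<close> and the polynomial have equal
  norms; degree \<open>2 * N\<close> in each variable gives the exponent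
  \<open>2 * (2 * N)\<close>.\<close>

lemma int_trig_small_set:
  assumes "int_trig N F" "\<not> (\<forall>x\<in>tri_params. F x = 0)" "0 < \<rho>" "\<rho> \<le> 1"
  shows "{x\<in>tri_params. norm (F x) < \<rho> ^ (4 * N)} \<in> sets borel"
    and "emeasure lborel {x\<in>tri_params. norm (F x) < \<rho> ^ (4 * N)} \<le> ennreal (32 * pi * real N * \<rho>)"
proof -
  obtain P where P: "int_poly2 (2 * N) P" "\<And>x :: real \<times> real. x \<in> tri_params \<Longrightarrow> F x * cis (N * (fst x + snd x)) = eval2 P x"
    using assms(1) unfolding int_trig_def by blast
  have nF: "norm (F x) = norm (eval2 P x)" if "x \<in> tri_params" for x
    using P(2)[OF that, symmetric] by (simp add: norm_mult)
  have nz: "P \<noteq> 0"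
  proof
    assume "P = 0"
    then have "F x = 0" if "x \<in> tri_params" for x using nF[OF that] by (simp add: eval2_def)
    then show False using assms(2) by blast
  qed
  have eq: "{x\<in>tri_params. norm (F x) < \<rho> ^ (4 * N)} = tri_params \<inter> {x. norm (eval2 P x) < \<rho> ^ (4 * N)}"
    using nF by auto
  have "open (tri_params \<inter> {x. norm (eval2 P x) < \<rho> ^ (4 * N)})"
    by (intro open_Int open_tri_params open_Collect_less continuous_intros continuous_eval2)
  then show "{x\<in>tri_params. norm (F x) < \<rho> ^ (4 * N)} \<in> sets borel" unfolding eq by simp
  have "{x\<in>tri_params. norm (F x) < \<rho> ^ (4 * N)} \<subseteq> {x \<in> {0..pi} \<times> {0..pi}. norm (eval2 P x) < \<rho> ^ (2 * (2 * N))}"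
    unfolding eq using tri_params_subset by auto
  moreover have "{x \<in> {0..pi} \<times> {0..pi}. norm (eval2 P x) < \<rho> ^ (2 * (2 * N))} \<in> sets borel"
    by (intro borel_closed_Collect_open open_Collect_less continuous_intros continuous_eval2
        closed_Times closed_atLeastAtMost)
  ultimately have "emeasure lborel {x\<in>tri_params. norm (F x) < \<rho> ^ (4 * N)} \<le>
     emeasure lborel {x \<in> {0..pi} \<times> {0..pi}. norm (eval2 P x) < \<rho> ^ (2 * (2 * N))}"
    by (intro emeasure_mono) auto
  also have "\<dots> \<le> ennreal (16 * pi * real (2 * N) * \<rho>)"
    using assms nz P by (intro emeasure_eval2_small_le)
  finally show "emeasure lborel {x\<in>tri_params. norm (F x) < \<rho> ^ (4 * N)} \<le> ennreal (32 * pi * real N * \<rho>)"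
    by (simp add: mult.assoc)
qed

section \<open>Vertices of an unfolding\<close>

text \<open>Reflection in the line carrying side \<open>a\<close>: in the line through
  \<open>c\<close> with unit direction \<open>e\<close> it is
  \<open>c + e\<^sup>2 * cnj (z - c)\<close>. Sides 0, 1, 2 have the directions \<open>1\<close>,
  \<open>cis (- \<beta>)\<close>, \<open>cis \<alpha>\<close> up to sign.\<close>

definition side_refl :: "real \<times> real \<Rightarrow> nat \<Rightarrow> complex \<Rightarrow> complex" where
  "side_refl x a z =
     (if a mod 3 = 0 then cnj z
      else if a mod 3 = 1 then 1 + cis (- 2 * snd x) * cnj (z - 1)
      else cis (2 * fst x) * cnj z)"

text \<open>Reflecting a moved copy in one of its own sides amounts to applying the fixed reflection
  first and the motion afterwards. Crossing sides in the order of \<open>w\<close> thus puts the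
  newest letter innermost.\<close>

definition unfold :: "real \<times> real \<Rightarrow> nat list \<Rightarrow> complex \<Rightarrow> complex" where
  "unfold x w = foldr (side_refl x) w"

definition unf_vertex :: "real \<times> real \<Rightarrow> nat list \<Rightarrow> nat \<Rightarrow> complex" where
  "unf_vertex x w q = unfold x w (tri_vertex (fst x) (snd x) q)"

text \<open>Multiplication by \<open>2 i sin (\<alpha> + \<beta>)\<close> clears the denominator of the apex.\<close>
definition sin_scale :: "real \<times> real \<Rightarrow> complex" where
  "sin_scale x = cis (fst x + snd x) - cis (- fst x - snd x)"

lemma sin_scale_eq: "sin_scale x = 2 * \<i> * sin (fst x + snd x)"
proof -
  have "- fst x - snd x = - (fst x + snd x)" by simp
  then show ?thesis by (simp only: sin_scale_def cis_cnj[symmetric]) (simp add: complex_eq_iff)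
qed

lemma norm_sin_scale_le: "norm (sin_scale x) \<le> 2"
  by (simp add: sin_scale_eq norm_mult)

lemma sin_scale_nonzero: "x \<in> tri_params \<Longrightarrow> sin_scale x \<noteq> 0"
  using sin_gt_zero[of "fst x + snd x"] by (auto simp: sin_scale_eq tri_params_def)

lemma int_trig_cong: "int_trig N F \<Longrightarrow> (\<And>x. x \<in> tri_params \<Longrightarrow> F x = G x) \<Longrightarrow> int_trig N G"
  unfolding int_trig_def by (metis (no_types, lifting))

lemma int_trig_sin_scale: "1 \<le> N \<Longrightarrow> int_trig N sin_scale"
  using int_trig_diff[OF int_trig_cis[of 1 N 1] int_trig_cis[of "-1" N "-1"]]
  by (simp add: sin_scale_def[abs_def])

text \<open>For the apex the scaling cancels the denominator and turns \<open>sin \<beta>\<close>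
  into a difference of exponentials. The conjugate is recorded separately, with the scaling itself
  left unconjugated, because reflections conjugate.\<close>

lemma int_trig_vertex:
  "int_trig 1 (\<lambda>x. sin_scale x * tri_vertex (fst x) (snd x) q)"
  "int_trig 1 (\<lambda>x. sin_scale x * cnj (tri_vertex (fst x) (snd x) q))"
proof -
  have *: "sin_scale x * complex_of_real (sin (snd x) / sin (fst x + snd x)) = cis (snd x) - cis (- snd x)"
    if "x \<in> tri_params" for x
    using sin_scale_nonzero[OF that] by (simp add: sin_scale_eq complex_eq_iff)
  have 1: "int_trig 1 (\<lambda>x. cis (fst x + snd x) - cis (fst x - snd x))"
    using int_trig_diff[OF int_trig_cis[of 1 1 1] int_trig_cis[of 1 1 "-1"]] by simp
  have 2: "int_trig 1 (\<lambda>x. cis (snd x - fst x) - cis (- fst x - snd x))"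
    using int_trig_diff[OF int_trig_cis[of "-1" 1 1] int_trig_cis[of "-1" 1 "-1"]] by (simp add: algebra_simps)
  consider "q mod 3 = 0" | "q mod 3 = 1" | "q mod 3 = 2" by linarith
  then have "int_trig 1 (\<lambda>x. sin_scale x * tri_vertex (fst x) (snd x) q) \<and>
    int_trig 1 (\<lambda>x. sin_scale x * cnj (tri_vertex (fst x) (snd x) q))"
  proof cases
    case 3
    show ?thesis
    proof
      have "cis (fst x + snd x) - cis (fst x - snd x) = sin_scale x * tri_vertex (fst x) (snd x) q"
        if "x \<in> tri_params" for x
        using 3 by (simp add: tri_vertex_def mult.assoc[symmetric] *[OF that] del: of_real_divide)
          (simp add: left_diff_distrib cis_mult algebra_simps)
      with 1 show "int_trig 1 (\<lambda>x. sin_scale x * tri_vertex (fst x) (snd x) q)"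
        by (rule int_trig_cong)
      have "cis (snd x - fst x) - cis (- fst x - snd x) = sin_scale x * cnj (tri_vertex (fst x) (snd x) q)"
        if "x \<in> tri_params" for x
        using 3 by (simp add: tri_vertex_def mult.assoc[symmetric] *[OF that] cis_cnj del: of_real_divide)
          (simp add: left_diff_distrib cis_mult algebra_simps)
      with 2 show "int_trig 1 (\<lambda>x. sin_scale x * cnj (tri_vertex (fst x) (snd x) q))"
        by (rule int_trig_cong)
    qed
  qed (simp_all add: tri_vertex_def int_trig_zero int_trig_sin_scale)
  then show "int_trig 1 (\<lambda>x. sin_scale x * tri_vertex (fst x) (snd x) q)"
    "int_trig 1 (\<lambda>x. sin_scale x * cnj (tri_vertex (fst x) (snd x) q))" by blast+
qed

text \<open>A reflection conjugates and multiplies by the square of a direction, an exponential of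
  degree 2. It exchanges the roles of the vertex and its conjugate, so both are carried
  along.\<close>

lemma int_trig_side_refl:
  assumes N: "1 \<le> N"
    and v: "int_trig N (\<lambda>x. sin_scale x * v x)" "int_trig N (\<lambda>x. sin_scale x * cnj (v x))"
  shows "int_trig (2 + N) (\<lambda>x. sin_scale x * side_refl x a (v x))"
    "int_trig (2 + N) (\<lambda>x. sin_scale x * cnj (side_refl x a (v x)))"
proof -
  have S: "int_trig N sin_scale" "int_trig (2 + N) sin_scale"
    using N by (auto intro: int_trig_sin_scale)
  have c: "int_trig 2 (\<lambda>x. cis (2 * fst x))" "int_trig 2 (\<lambda>x. cis (- (2 * fst x)))"
    "int_trig 2 (\<lambda>x. cis (2 * snd x))" "int_trig 2 (\<lambda>x. cis (- (2 * snd x)))"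
    using int_trig_cis[of 2 2 0] int_trig_cis[of "-2" 2 0] int_trig_cis[of 0 2 2] int_trig_cis[of 0 2 "-2"]
    by simp_all
  consider "a mod 3 = 0" | "a mod 3 = 1" | "a mod 3 = 2" by linarith
  then have "int_trig (2 + N) (\<lambda>x. sin_scale x * side_refl x a (v x)) \<and>
    int_trig (2 + N) (\<lambda>x. sin_scale x * cnj (side_refl x a (v x)))"
  proof cases
    case 1
    then show ?thesis
      using v by (auto simp: side_refl_def intro: int_trig_mono)
  next
    case 2
    show ?thesis
    proof
      have "int_trig (2 + N) (\<lambda>x. sin_scale x + cis (- (2 * snd x)) * (sin_scale x * cnj (v x) - sin_scale x))"
        by (intro int_trig_add int_trig_mult int_trig_diff S c v)
      then show "int_trig (2 + N) (\<lambda>x. sin_scale x * side_refl x a (v x))"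
        by (rule int_trig_cong) (simp add: side_refl_def 2 algebra_simps)
      have "int_trig (2 + N) (\<lambda>x. sin_scale x + cis (2 * snd x) * (sin_scale x * v x - sin_scale x))"
        by (intro int_trig_add int_trig_mult int_trig_diff S c v)
      then show "int_trig (2 + N) (\<lambda>x. sin_scale x * cnj (side_refl x a (v x)))"
        by (rule int_trig_cong) (simp add: side_refl_def 2 cis_cnj algebra_simps)
    qed
  next
    case 3
    show ?thesis
    proof
      have "int_trig (2 + N) (\<lambda>x. cis (2 * fst x) * (sin_scale x * cnj (v x)))"
        by (intro int_trig_mult c v)
      then show "int_trig (2 + N) (\<lambda>x. sin_scale x * side_refl x a (v x))"
        by (rule int_trig_cong) (simp add: side_refl_def 3)
      have "int_trig (2 + N) (\<lambda>x. cis (- (2 * fst x)) * (sin_scale x * v x))"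
        by (intro int_trig_mult c v)
      then show "int_trig (2 + N) (\<lambda>x. sin_scale x * cnj (side_refl x a (v x)))"
        by (rule int_trig_cong) (simp add: side_refl_def 3 cis_cnj)
    qed
  qed
  then show "int_trig (2 + N) (\<lambda>x. sin_scale x * side_refl x a (v x))"
    "int_trig (2 + N) (\<lambda>x. sin_scale x * cnj (side_refl x a (v x)))" by blast+
qed

lemma int_trig_unf_vertex:
  "int_trig (2 * length w + 1) (\<lambda>x. sin_scale x * unf_vertex x w q) \<and>
   int_trig (2 * length w + 1) (\<lambda>x. sin_scale x * cnj (unf_vertex x w q))"
proof (induction w)
  case Nil
  show ?case using int_trig_vertex[of q] by (simp add: unf_vertex_def unfold_def)
next
  case (Cons a w)
  then show ?case
    using int_trig_side_refl[of "2 * length w + 1" "\<lambda>x. unf_vertex x w q" a]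
    by (simp add: unf_vertex_def unfold_def)
qed

section \<open>Cross products of vertex triples and their generic size\<close>

text \<open>This is \<open>Im (cnj a * b)\<close>, twice the signed area of the triangle with
  vertices 0, \<open>a\<close>, \<open>b\<close>.\<close>

definition cr :: "complex \<Rightarrow> complex \<Rightarrow> real" where
  "cr a b = Re a * Im b - Im a * Re b"

lemma cnj_mult_minus: "cnj a * b - a * cnj b = 2 * \<i> * cr a b"
  by (simp add: cr_def complex_eq_iff)

text \<open>Up to \<open>2 * \<i>\<close> the cross product is a difference of products of one
  vertex difference and one conjugate difference, each of degree \<open>2 * m + 1\<close> after
  scaling.\<close>

lemma int_trig_cr:
  assumes "length u \<le> m" "length v \<le> m" "length w \<le> m"
  shows "int_trig (4 * m + 2) (\<lambda>x. (sin_scale x)\<^sup>2 *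
     (2 * \<i> * cr (unf_vertex x v q - unf_vertex x u p) (unf_vertex x w r - unf_vertex x u p)))"
proof -
  have *: "int_trig (2 * m + 1) (\<lambda>x. sin_scale x * unf_vertex x w q)"
    "int_trig (2 * m + 1) (\<lambda>x. sin_scale x * cnj (unf_vertex x w q))" if "length w \<le> m" for w q
    using int_trig_unf_vertex[of w q] that by (auto intro: int_trig_mono)
  let ?v = "\<lambda>x. sin_scale x * unf_vertex x v q - sin_scale x * unf_vertex x u p"
  let ?w = "\<lambda>x. sin_scale x * unf_vertex x w r - sin_scale x * unf_vertex x u p"
  let ?v' = "\<lambda>x. sin_scale x * cnj (unf_vertex x v q) - sin_scale x * cnj (unf_vertex x u p)"
  let ?w' = "\<lambda>x. sin_scale x * cnj (unf_vertex x w r) - sin_scale x * cnj (unf_vertex x u p)"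
  have "int_trig ((2 * m + 1) + (2 * m + 1)) (\<lambda>x. ?v' x * ?w x - ?v x * ?w' x)"
    using assms by (intro int_trig_diff int_trig_mult *)
  moreover have "?v' x * ?w x - ?v x * ?w' x = (sin_scale x)\<^sup>2 *
     (2 * \<i> * cr (unf_vertex x v q - unf_vertex x u p) (unf_vertex x w r - unf_vertex x u p))" for x
    by (subst cnj_mult_minus[symmetric]) (simp add: power2_eq_square algebra_simps)
  ultimately show ?thesis by (simp add: algebra_simps)
qed

text \<open>\<open>rho m\<close> must beat the number \<open>3 ^ m\<close> of words to be summable; \<open>theta m\<close> is what
  \<open>int_trig_small_set\<close> then gives in degree \<open>4 m + 2\<close>.\<close>
definition rho :: "nat \<Rightarrow> real" where
  "rho m = exp (- (real m powr (3/2)))"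

definition theta :: "nat \<Rightarrow> real" where
  "theta m = rho m ^ (4 * (4 * m + 2)) / 8"

definition vertex_cr :: "real \<times> real \<Rightarrow> nat list \<times> nat list \<times> nat list \<times> nat \<times> nat \<times> nat \<Rightarrow> real" where
  "vertex_cr x = (\<lambda>(u, v, w, p, q, r).
     cr (unf_vertex x v q - unf_vertex x u p) (unf_vertex x w r - unf_vertex x u p))"

text \<open>These triples describe the vertices met within one block of \<open>m\<close> steps, seen
  from the copy at its start. All three words are prefixes of a single word, which keeps the number
  of triples at \<open>3 ^ m\<close> times a polynomial.\<close>

definition prefix_triples :: "nat \<Rightarrow> (nat list \<times> nat list \<times> nat list \<times> nat \<times> nat \<times> nat) set" where
  "prefix_triples m = (\<lambda>(w, i, j, k, p, q, r). (take i w, take j w, take k w, p, q, r)) `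
     ({w. set w \<subseteq> {..<3} \<and> length w = m} \<times> {..m} \<times> {..m} \<times> {..m} \<times> {..<3} \<times> {..<3} \<times> {..<3})"

lemma finite_prefix_triples: "finite (prefix_triples m)"
  and card_prefix_triples: "card (prefix_triples m) \<le> 3 ^ m * ((m + 1) ^ 3 * 27)"
proof -
  let ?A = "{w. set w \<subseteq> {..<3::nat} \<and> length w = m} \<times> {..m} \<times> {..m} \<times> {..m} \<times> {..<3::nat} \<times> {..<3::nat} \<times> {..<3::nat}"
  have fin: "finite ?A" by (intro finite_cartesian_product finite_lists_length_eq) auto
  then show "finite (prefix_triples m)" unfolding prefix_triples_def by (rule finite_imageI)
  have "card (prefix_triples m) \<le> card ?A" unfolding prefix_triples_def by (rule card_image_le[OF fin])
  also have "\<dots> = 3 ^ m * ((m + 1) ^ 3 * 27)"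
    by (simp only: card_cartesian_product card_lists_length_eq[OF finite_lessThan] card_lessThan card_atMost power3_eq_cube Suc_eq_plus1 mult.assoc)
  finally show "card (prefix_triples m) \<le> 3 ^ m * ((m + 1) ^ 3 * 27)" .
qed

lemma rho_pos: "0 < rho m" and rho_le_1: "rho m \<le> 1"
  by (simp_all add: rho_def)

lemma theta_pos: "0 < theta m"
  by (simp add: theta_def rho_pos)

text \<open>Every scaled cross product is an integer trigonometric polynomial. Where it does not
  vanish identically, the set of parameters making it tiny has measure of order
  \<open>m * rho m\<close>; the sum over all triples is summable in \<open>m\<close>, and
  Borel-Cantelli applies.\<close>

lemma generic_collinear:
  "AE x in lborel. x \<in> tri_params \<longrightarrow>
     (\<forall>\<^sub>F m in sequentially. \<forall>t\<in>prefix_triples m. vertex_cr x t = 0 \<or> theta m \<le> \<bar>vertex_cr x t\<bar>)"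
proof -
  define F where "F t x = (sin_scale x)\<^sup>2 * (2 * \<i> * vertex_cr x t)" for t x
  have trig: "int_trig (4 * m + 2) (F t)" if "t \<in> prefix_triples m" for t m
    using that int_trig_cr[of _ m] by (auto simp: prefix_triples_def F_def[abs_def] vertex_cr_def)
  \<comment> \<open>A triple that is collinear for every triangle gives nothing to remove; it falls
    under the alternative \<open>vertex_cr x t = 0\<close>.\<close>
  define D where "D m t = (if \<forall>x\<in>tri_params. F t x = 0 then {}
     else {x \<in> tri_params. norm (F t x) < rho m ^ (4 * (4 * m + 2))})" for m t
  define B where "B m = (\<Union>t\<in>prefix_triples m. D m t)" for m
  have Dm: "D m t \<in> sets lborel" if "t \<in> prefix_triples m" for m t
    using int_trig_small_set(1)[OF trig[OF that] _ rho_pos rho_le_1] by (simp add: D_def)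
  have De: "emeasure lborel (D m t) \<le> ennreal (32 * pi * real (4 * m + 2) * rho m)" if "t \<in> prefix_triples m" for m t
    using int_trig_small_set(2)[OF trig[OF that] _ rho_pos rho_le_1] rho_pos[of m] by (simp add: D_def)
  define b where "b m = real (3 ^ m * ((m + 1) ^ 3 * 27)) * (32 * pi * real (4 * m + 2) * rho m)" for m
  have b0: "0 \<le> b m" for m using rho_pos[of m] by (simp add: b_def)
  have Bm: "B m \<in> sets lborel" for m
    unfolding B_def using Dm finite_prefix_triples by (intro sets.finite_UN) auto
  have Be: "emeasure lborel (B m) \<le> ennreal (b m)" for m
  proof -
    have "emeasure lborel (B m) \<le> (\<Sum>t\<in>prefix_triples m. emeasure lborel (D m t))"
      unfolding B_def using Dm finite_prefix_triples by (intro emeasure_subadditive_finite) auto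
    also have "\<dots> \<le> (\<Sum>t\<in>prefix_triples m. ennreal (32 * pi * real (4 * m + 2) * rho m))"
      by (intro sum_mono De)
    also have "\<dots> = ennreal (real (card (prefix_triples m)) * (32 * pi * real (4 * m + 2) * rho m))"
      using rho_pos[of m] by (simp add: ennreal_of_nat_eq_real_of_nat ennreal_mult'[symmetric])
    also have "\<dots> \<le> ennreal (b m)"
      unfolding b_def using rho_pos[of m] card_prefix_triples[of m]
      by (intro ennreal_leI mult_right_mono of_nat_mono) auto
    finally show ?thesis .
  qed
  have "summable b"
  proof (rule summable_comparison_test_ev)
    have "b = (\<lambda>m. 3 ^ m * ((real m + 1) ^ 3 * 27) * (32 * pi * (4 * real m + 2) * exp (- (real m powr (3/2)))))"
      by (rule ext) (simp only: b_def rho_def of_nat_mult of_nat_power of_nat_add of_nat_numeral of_nat_1)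
    \<comment> \<open>The power \<open>m powr (3/2)\<close> outgrows \<open>m * ln 6\<close>, which
      covers both \<open>3 ^ m\<close> and the comparison with \<open>(1/2) ^ m\<close>.\<close>
    moreover have "\<forall>\<^sub>F m in sequentially. 3 ^ m * ((real m + 1) ^ 3 * 27) * (32 * pi * (4 * real m + 2) * exp (- (real m powr (3/2)))) \<le> (1/2) ^ m"
      by real_asymp
    ultimately have "\<forall>\<^sub>F m in sequentially. b m \<le> (1/2) ^ m" by (simp only:)
    then show "\<forall>\<^sub>F m in sequentially. norm (b m) \<le> (1/2) ^ m" using b0 by simp
  qed (simp add: summable_geometric)
  moreover have "measure lborel (B m) \<le> b m" for m
    unfolding measure_def using enn2real_mono[OF Be[of m]] b0 by simp
  ultimately have "summable (\<lambda>m. measure lborel (B m))"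
    by (auto intro!: summable_comparison_test[of "\<lambda>m. measure lborel (B m)" b])
  moreover have "emeasure lborel (B m) < \<infinity>" for m
    using Be[of m] by (rule le_less_trans) simp
  ultimately have "AE x in lborel. \<forall>\<^sub>F m in sequentially. x \<in> space lborel - B m"
    using Bm by (intro borel_cantelli_AE1) auto
  then show ?thesis
  proof (rule AE_mp, intro AE_I2 impI)
    fix x assume x: "x \<in> tri_params" and ev: "\<forall>\<^sub>F m in sequentially. x \<in> space lborel - B m"
    from ev show "\<forall>\<^sub>F m in sequentially. \<forall>t\<in>prefix_triples m. vertex_cr x t = 0 \<or> theta m \<le> \<bar>vertex_cr x t\<bar>"
    proof (rule eventually_mono)
      fix m assume m: "x \<in> space lborel - B m"
      show "\<forall>t\<in>prefix_triples m. vertex_cr x t = 0 \<or> theta m \<le> \<bar>vertex_cr x t\<bar>"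
      proof
        fix t assume t: "t \<in> prefix_triples m"
        have S: "sin_scale x \<noteq> 0" using x by (rule sin_scale_nonzero)
        show "vertex_cr x t = 0 \<or> theta m \<le> \<bar>vertex_cr x t\<bar>"
        proof (cases "\<forall>x\<in>tri_params. F t x = 0")
          case True
          then show ?thesis using S x by (auto simp: F_def)
        next
          case False
          have "x \<notin> D m t" using m t by (auto simp: B_def)
          then have "rho m ^ (4 * (4 * m + 2)) \<le> norm (F t x)"
            using False x by (auto simp: D_def)
          also have "norm (F t x) = (norm (sin_scale x))\<^sup>2 * (2 * \<bar>vertex_cr x t\<bar>)"
            by (simp add: F_def norm_mult norm_power)
          \<comment> \<open>The bound 2 on \<open>sin_scale\<close>, squared, and the factor 2 in
            \<open>F\<close> account for the divisor 8 in \<open>theta\<close>.\<close>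
          also have "\<dots> \<le> 2\<^sup>2 * (2 * \<bar>vertex_cr x t\<bar>)"
            using norm_sin_scale_le by (intro mult_right_mono power_mono) auto
          finally show ?thesis by (simp add: theta_def)
        qed
      qed
    qed
  qed
qed

section \<open>Lines in an unfolding\<close>

lemma unfold_append: "unfold x (v @ w) z = unfold x v (unfold x w z)"
  by (simp add: unfold_def)

lemma unfold_Nil [simp]: "unfold x [] z = z"
  by (simp add: unfold_def)

lemma unfold_Cons: "unfold x (a # w) z = side_refl x a (unfold x w z)"
  by (simp add: unfold_def)

text \<open>A reflection is \<open>A * cnj z\<close> plus a constant, and the constant drops out of
  differences.\<close>

lemma side_refl_diff:
  obtains A where "norm A = 1" "\<And>z z'. side_refl x a z - side_refl x a z' = A * cnj (z - z')"
proof -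
  consider "a mod 3 = 0" | "a mod 3 = 1" | "a mod 3 = 2" by linarith
  then show ?thesis
  proof cases
    case 1
    show ?thesis by (rule that[of 1]) (use 1 in \<open>auto simp: side_refl_def\<close>)
  next
    case 2
    show ?thesis by (rule that[of "cis (- 2 * snd x)"]) (use 2 in \<open>auto simp: side_refl_def algebra_simps\<close>)
  next
    case 3
    show ?thesis by (rule that[of "cis (2 * fst x)"]) (use 3 in \<open>auto simp: side_refl_def algebra_simps\<close>)
  qed
qed

lemma dist_unfold: "dist (unfold x w z) (unfold x w z') = dist z z'"
proof (induction w)
  case (Cons a w)
  obtain A where "norm A = 1" "\<And>z z'. side_refl x a z - side_refl x a z' = A * cnj (z - z')"
    using side_refl_diff by blast
  then have "dist (side_refl x a u) (side_refl x a u') = dist u u'" for u u'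
    by (simp only: dist_norm norm_mult complex_mod_cnj)
  then show ?case using Cons by (simp add: unfold_Cons)
qed simp

lemma unfold_diff_scaleR:
  "z - z' = t *\<^sub>R (y - y') \<Longrightarrow> unfold x w z - unfold x w z' = t *\<^sub>R (unfold x w y - unfold x w y')"
proof (induction w)
  case (Cons a w)
  obtain A where A: "norm A = 1" "\<And>z z'. side_refl x a z - side_refl x a z' = A * cnj (z - z')"
    using side_refl_diff by blast
  show ?case using Cons by (simp only: unfold_Cons A(2)) simp
qed simp

lemma cr_unit_cnj: "norm A = 1 \<Longrightarrow> cr (A * cnj a) (A * cnj b) = - cr a b"
proof -
  assume "norm A = 1"
  then have "(Re A)\<^sup>2 + (Im A)\<^sup>2 = 1" by (simp add: cmod_def)
  moreover have "cr (A * cnj a) (A * cnj b) = - ((Re A)\<^sup>2 + (Im A)\<^sup>2) * cr a b"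
    by (simp add: cr_def power2_eq_square algebra_simps)
  ultimately show ?thesis by simp
qed

lemma cr_unfold:
  "cr (unfold x w a - unfold x w c) (unfold x w b - unfold x w c) = (-1) ^ length w * cr (a - c) (b - c)"
proof (induction w)
  case (Cons q w)
  obtain A where A: "norm A = 1" "\<And>z z'. side_refl x q z - side_refl x q z' = A * cnj (z - z')"
    using side_refl_diff by blast
  show ?case using Cons by (simp only: unfold_Cons A(2) cr_unit_cnj[OF A(1)]) simp
qed simp

lemma tri_vertex_mod [simp]: "tri_vertex \<alpha> \<beta> (q mod 3) = tri_vertex \<alpha> \<beta> q"
  by (simp add: tri_vertex_def)

text \<open>The apex as seen from vertex 1; the two descriptions agree by the addition formula for
  the sine. This form makes the apex visibly fixed by the reflection in side 1.\<close>

lemma apex_eq: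
  assumes "sin (\<alpha> + \<beta>) \<noteq> 0"
  shows "complex_of_real (sin \<beta> / sin (\<alpha> + \<beta>)) * cis \<alpha> = 1 - complex_of_real (sin \<alpha> / sin (\<alpha> + \<beta>)) * cis (- \<beta>)"
proof -
  have "sin \<beta> / sin (\<alpha> + \<beta>) * cos \<alpha> + sin \<alpha> / sin (\<alpha> + \<beta>) * cos \<beta> =
      (sin \<beta> * cos \<alpha> + sin \<alpha> * cos \<beta>) / sin (\<alpha> + \<beta>)"
    by (simp add: add_divide_distrib)
  also have "\<dots> = 1" using assms by (simp add: sin_add mult.commute add.commute)
  finally show ?thesis by (simp add: complex_eq_iff del: of_real_divide)
qed

lemma sin_params_nonzero: "x \<in> tri_params \<Longrightarrow> sin (fst x + snd x) \<noteq> 0"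
  using sin_gt_zero[of "fst x + snd x"] by (auto simp: tri_params_def)

lemma mod3_cases:
  obtains "(a::nat) mod 3 = 0" "(a + 1) mod 3 = 1" | "a mod 3 = 1" "(a + 1) mod 3 = 2"
    | "a mod 3 = 2" "(a + 1) mod 3 = 0"
  by atomize_elim presburger

lemma side_refl_fix:
  assumes "x \<in> tri_params" "p \<in> {tri_vertex (fst x) (snd x) a, tri_vertex (fst x) (snd x) (a + 1)}"
  shows "side_refl x a p = p"
proof (cases rule: mod3_cases[of a])
  case 1
  then show ?thesis using assms by (auto simp: side_refl_def tri_vertex_def)
next
  case 2
  have "cis (- 2 * snd x) * cnj (tri_vertex (fst x) (snd x) 2 - 1) = tri_vertex (fst x) (snd x) 2 - 1"
    unfolding tri_vertex_def using apex_eq[OF sin_params_nonzero[OF assms(1)]]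
    by (simp add: cis_cnj del: of_real_divide) (simp add: mult.left_commute cis_mult)
  then show ?thesis using assms 2 by (auto simp: side_refl_def tri_vertex_def)
next
  case 3
  then show ?thesis using assms by (auto simp: side_refl_def tri_vertex_def cis_cnj)
     (simp add: mult.left_commute cis_mult)
qed

lemma side_refl_fix_segment:
  assumes x: "x \<in> tri_params" and p: "p \<in> side (tri_vertex (fst x) (snd x)) a"
  shows "side_refl x a p = p"
proof -
  let ?V = "tri_vertex (fst x) (snd x)"
  have "p \<in> open_segment (?V a) (?V (a + 1))" using p tri_vertex_mod[of "fst x" "snd x" "a + 1"] by (simp add: side_def)
  then obtain u where u: "p = (1 - u) *\<^sub>R ?V a + u *\<^sub>R ?V (a + 1)" by (auto simp: in_segment)
  have "p - ?V a = u *\<^sub>R (?V (a + 1) - ?V a)" by (simp add: u algebra_simps)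
  from unfold_diff_scaleR[OF this, of x "[a]"]
  have "side_refl x a p - ?V a = p - ?V a"
    using side_refl_fix[OF x, of "?V a" a] side_refl_fix[OF x, of "?V (a + 1)" a]
    by (simp add: unfold_Cons u algebra_simps)
  then show ?thesis by simp
qed

text \<open>Translates the inner-product form of the reflection law into the complex form used by
  \<open>side_refl\<close>.\<close>

lemma line_reflect_eq: "u \<noteq> 0 \<Longrightarrow> line_reflect u d = (u / cnj u) * cnj d"
proof -
  assume u: "u \<noteq> 0"
  have n: "u * cnj u = of_real (u \<bullet> u)" by (simp add: complex_eq_iff inner_complex_def power2_eq_square)
  have "u / cnj u = u * u / (u * cnj u)" using u by simp
  also have "\<dots> = u * u / of_real (u \<bullet> u)" by (simp only: n)
  finally have q: "u / cnj u = u * u / of_real (u \<bullet> u)" .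
  have uu: "u \<bullet> u \<noteq> 0" using u by simp
  have "(line_reflect u d) * of_real (u \<bullet> u) = u * u * cnj d"
  proof -
    have "(line_reflect u d) * of_real (u \<bullet> u) = of_real (2 * ((d \<bullet> u) / (u \<bullet> u)) * (u \<bullet> u)) * u - d * of_real (u \<bullet> u)"
      by (simp add: line_reflect_def scaleR_conv_of_real left_diff_distrib)
    also have "2 * ((d \<bullet> u) / (u \<bullet> u)) * (u \<bullet> u) = 2 * (d \<bullet> u)" using uu by simp
    also have "of_real (2 * (d \<bullet> u)) * u - d * of_real (u \<bullet> u) = u * u * cnj d"
      by (simp add: complex_eq_iff inner_complex_def algebra_simps)
    finally show ?thesis .
  qed
  then show ?thesis unfolding q using uu by (simp add: field_simps)
qed

text \<open>The unimodular factor \<open>A\<close> of the reflection is determined by the edge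
  \<open>u\<close>: both ends of the side are fixed, so \<open>u = A * cnj u\<close>.\<close>

lemma side_refl_line_reflect:
  assumes x: "x \<in> tri_params"
  shows "side_refl x a z - side_refl x a z' =
     line_reflect (tri_vertex (fst x) (snd x) (a + 1) - tri_vertex (fst x) (snd x) a) (z - z')"
proof -
  let ?u = "tri_vertex (fst x) (snd x) (a + 1) - tri_vertex (fst x) (snd x) a"
  obtain A where A: "norm A = 1" "\<And>z z'. side_refl x a z - side_refl x a z' = A * cnj (z - z')"
    using side_refl_diff by blast
  have pos: "sin (fst x + snd x) > 0" "sin (fst x) > 0" "sin (snd x) > 0"
    using x by (auto simp: tri_params_def intro!: sin_gt_zero)
  have nz: "?u \<noteq> 0"
    by (cases rule: mod3_cases[of a])
      (use pos in \<open>auto simp: tri_vertex_def complex_eq_iff\<close>)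
  have "?u = side_refl x a (tri_vertex (fst x) (snd x) (a + 1)) - side_refl x a (tri_vertex (fst x) (snd x) a)"
    using side_refl_fix[OF x, of "tri_vertex (fst x) (snd x) (a + 1)" a]
      side_refl_fix[OF x, of "tri_vertex (fst x) (snd x) a" a] by simp
  also have "\<dots> = A * cnj ?u" by (rule A(2))
  finally have "?u = A * cnj ?u" .
  moreover have "cnj ?u \<noteq> 0" using nz by (simp only: complex_cnj_zero_iff not_False_eq_True)
  ultimately have "A = ?u / cnj ?u" by (metis nonzero_mult_div_cancel_right)
  then show ?thesis using A(2) line_reflect_eq[OF nz] by simp
qed

text \<open>Twice the signed area does not depend on the starting vertex, and the base from 0 to 1
  has length 1.\<close>

lemma cr_tri_vertex:
  "cr (tri_vertex \<alpha> \<beta> (q + 1) - tri_vertex \<alpha> \<beta> q) (tri_vertex \<alpha> \<beta> (q + 2) - tri_vertex \<alpha> \<beta> q) =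
     Im (tri_vertex \<alpha> \<beta> 2)"
proof -
  have "(q + 2) mod 3 = (q + 1 + 1) mod 3" by simp
  then show ?thesis
    by (cases rule: mod3_cases[of q]; cases rule: mod3_cases[of "q + 1"])
      (auto simp: tri_vertex_def cr_def algebra_simps)
qed

definition apex_height :: "real \<times> real \<Rightarrow> real" where
  "apex_height x = Im (tri_vertex (fst x) (snd x) 2)"

lemma apex_height_pos: "x \<in> tri_params \<Longrightarrow> 0 < apex_height x"
  by (auto simp: apex_height_def tri_vertex_def tri_params_def intro!: divide_pos_pos mult_pos_pos sin_gt_zero)

text \<open>A crude common bound for the side lengths and for the distances of the vertices from the
  origin.\<close>

definition tri_size :: "real \<times> real \<Rightarrow> real" where
  "tri_size x = 1 + norm (tri_vertex (fst x) (snd x) 2)"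

lemma tri_size_ge_1: "1 \<le> tri_size x"
  by (simp add: tri_size_def)

lemma norm_tri_vertex_le: "norm (tri_vertex (fst x) (snd x) q) \<le> tri_size x"
  by (auto simp: tri_size_def tri_vertex_def)

lemma dist_tri_vertex_le: "dist (tri_vertex (fst x) (snd x) q) (tri_vertex (fst x) (snd x) r) \<le> tri_size x"
proof -
  have *: "tri_vertex (fst x) (snd x) q \<in> {0, 1, tri_vertex (fst x) (snd x) 2}" for q
    by (auto simp: tri_vertex_def)
  then show ?thesis
    using *[of q] *[of r] norm_triangle_ineq4[of 1 "tri_vertex (fst x) (snd x) 2"]
      norm_triangle_ineq4[of "tri_vertex (fst x) (snd x) 2" 1]
    by (elim insertE emptyE) (simp_all add: dist_norm tri_size_def add.commute)
qed

text \<open>Both vectors are written in the orthonormal frame of \<open>d\<close> and its quarter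
  turn.\<close>

lemma cr_expand:
  assumes "norm d = 1"
  shows "cr u v = (u \<bullet> d) * cr d v - cr d u * (v \<bullet> d)"
proof -
  have "(Re d)\<^sup>2 + (Im d)\<^sup>2 = 1" using assms by (simp add: cmod_def)
  moreover have "(u \<bullet> d) * cr d v - cr d u * (v \<bullet> d) = ((Re d)\<^sup>2 + (Im d)\<^sup>2) * cr u v"
    by (simp add: cr_def inner_complex_def power2_eq_square algebra_simps)
  ultimately show ?thesis by simp
qed

lemma abs_cr_le: "\<bar>cr a b\<bar> \<le> norm a * norm b"
proof -
  have "cr a b = (\<i> * a) \<bullet> b" by (simp add: cr_def inner_complex_def)
  then show ?thesis using Cauchy_Schwarz_ineq2[of "\<i> * a" b] by (simp add: norm_mult)
qed

lemma cr_minus_left: "cr (- a) b = - cr a b"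
  by (simp add: cr_def)

text \<open>Expanding \<open>K\<close> along \<open>d\<close> gives
  \<open>(e \<bullet> d) * cr d w + (w \<bullet> d) * cr e d\<close>. When \<open>w\<close> is
  almost parallel to \<open>d\<close> the first term is smaller than \<open>K\<close>, so the second
  has the sign of \<open>K\<close>.\<close>

lemma inner_pos_of_cr:
  assumes d: "norm d = 1" and o: "cr e w = K" "0 < K * cr e d" and near: "\<bar>cr d w\<bar> * norm e < \<bar>K\<bar>"
  shows "0 < w \<bullet> d"
proof -
  have "K = (e \<bullet> d) * cr d w + (w \<bullet> d) * cr e d"
    using cr_expand[OF d, of e w] o(1) by (simp add: cr_def algebra_simps)
  then have "(w \<bullet> d) * (K * cr e d) = K * K - K * ((e \<bullet> d) * cr d w)"
    by (simp add: algebra_simps)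
  moreover have "\<bar>(e \<bullet> d) * cr d w\<bar> < \<bar>K\<bar>"
  proof -
    have "\<bar>e \<bullet> d\<bar> \<le> norm e" using Cauchy_Schwarz_ineq2[of e d] d by simp
    then have "\<bar>(e \<bullet> d) * cr d w\<bar> \<le> norm e * \<bar>cr d w\<bar>" by (simp add: abs_mult mult_right_mono)
    then show ?thesis using near by (simp add: mult.commute)
  qed
  then have "\<bar>K * ((e \<bullet> d) * cr d w)\<bar> < \<bar>K\<bar> * \<bar>K\<bar>"
    using o(2) by (subst abs_mult, intro mult_strict_left_mono) auto
  then have "K * ((e \<bullet> d) * cr d w) < K * K" by (simp add: abs_mult_self_eq)
  ultimately have "0 < (w \<bullet> d) * (K * cr e d)" by linarith
  then show ?thesis using o(2) by (simp add: zero_less_mult_iff)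
qed

section \<open>A straight line through the chain of triangle copies\<close>

text \<open>Copy \<open>j\<close> is reached by crossing sides \<open>s 1\<close> to
  \<open>s j\<close>; \<open>s 0\<close> carries the starting point and causes no
  reflection.\<close>

definition vx :: "real \<times> real \<Rightarrow> (nat \<Rightarrow> nat) \<Rightarrow> nat \<Rightarrow> nat \<Rightarrow> complex" where
  "vx x s j q = unf_vertex x (map s [1..<Suc j]) q"

lemma vx_mod: "q mod 3 = r mod 3 \<Longrightarrow> vx x s j q = vx x s j r"
  using tri_vertex_mod[of "fst x" "snd x" q] tri_vertex_mod[of "fst x" "snd x" r]
  by (simp add: vx_def unf_vertex_def)

lemma vx_Suc:
  assumes "x \<in> tri_params" "q \<in> {s (Suc j), s (Suc j) + 1}"
  shows "vx x s (Suc j) q = vx x s j q"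
  using side_refl_fix[OF assms(1), of "tri_vertex (fst x) (snd x) q" "s (Suc j)"] assms(2)
  by (auto simp: vx_def unf_vertex_def unfold_append unfold_Cons)

lemma cr_vx: "cr (vx x s j (q + 1) - vx x s j q) (vx x s j (q + 2) - vx x s j q) = (-1) ^ j * apex_height x"
  unfolding vx_def unf_vertex_def cr_unfold cr_tri_vertex apex_height_def
  by (simp del: upt_Suc)

lemma dist_vx_le: "dist (vx x s j q) (vx x s j r) \<le> tri_size x"
  unfolding vx_def unf_vertex_def dist_unfold by (rule dist_tri_vertex_le)

lemma vx_cong: "(\<And>i. 1 \<le> i \<Longrightarrow> i \<le> j \<Longrightarrow> s i = s' i) \<Longrightarrow> vx x s j q = vx x s' j q"
proof -
  assume "\<And>i. 1 \<le> i \<Longrightarrow> i \<le> j \<Longrightarrow> s i = s' i"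
  then have "map s [1..<Suc j] = map s' [1..<Suc j]" by (intro map_cong) auto
  then show ?thesis by (simp only: vx_def)
qed

text \<open>The vertex opposite the side of entry; its position relative to the line decides the
  side of exit.\<close>

definition new_vertex :: "real \<times> real \<Rightarrow> (nat \<Rightarrow> nat) \<Rightarrow> nat \<Rightarrow> complex" where
  "new_vertex x s j = vx x s j (s j + 2)"

text \<open>A billiard orbit after unfolding: a ray from \<open>P\<close> in the unit direction
  \<open>d\<close>, with \<open>\<tau> j\<close> the arc length at the crossing into copy
  \<open>j\<close>, and the start on side \<open>s 0\<close> of the original triangle.\<close>

locale unfolded_line =
  fixes x :: "real \<times> real" and s :: "nat \<Rightarrow> nat" and P d :: complex and \<tau> :: "nat \<Rightarrow> real"
  assumes params: "x \<in> tri_params" and unit: "norm d = 1"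
    and s_less: "s j < 3" and s_change: "s (Suc j) \<noteq> s j"
    and tau_0: "\<tau> 0 = 0" and tau_Suc: "\<tau> j < \<tau> (Suc j)"
    and on_side: "P + \<tau> j *\<^sub>R d \<in> open_segment (vx x s j (s j)) (vx x s j (s j + 1))"
begin

abbreviation "pt j \<equiv> P + \<tau> j *\<^sub>R d"
abbreviation "va j \<equiv> vx x s j (s j)"
abbreviation "vb j \<equiv> vx x s j (s j + 1)"
abbreviation "vc j \<equiv> new_vertex x s j"
abbreviation "orient j \<equiv> (-1) ^ j * apex_height x"
abbreviation "turn_left j \<equiv> s (Suc j) mod 3 = (s j + 1) mod 3"

text \<open>The signed distance of the new vertex from the line, \<open>d\<close> being a unit
  vector.\<close>

definition offset :: "nat \<Rightarrow> real" where "offset j = cr d (vc j - P)"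

lemma orient: "cr (vb j - va j) (vc j - va j) = orient j" 
  using cr_vx[of x s j "s j"] by (simp add: new_vertex_def)

lemma abs_orient: "\<bar>orient j\<bar> = apex_height x"
  using apex_height_pos[OF params] by (simp add: abs_mult)

text \<open>Consecutive sides differ, so the exit side joins the new vertex to one end of the entry
  side. Here \<open>turn_left\<close> refers to labels only; the geometric side alternates with the
  reflections, which \<open>orient\<close> takes into account.\<close>

lemma exit_cases:
  obtains "turn_left j" "va (Suc j) = vb j" "vb (Suc j) = vc j"
  | "\<not> turn_left j" "va (Suc j) = vc j" "vb (Suc j) = va j"
proof -
  have "s (Suc j) mod 3 = (s j + 1) mod 3 \<or> s (Suc j) mod 3 = (s j + 2) mod 3 \<and> s (Suc j) mod 3 \<noteq> (s j + 1) mod 3"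
  proof -
    have "s j = 0 \<or> s j = 1 \<or> s j = 2" "s (Suc j) = 0 \<or> s (Suc j) = 1 \<or> s (Suc j) = 2"
      using s_less[of j] s_less[of "Suc j"] by linarith+
    then show ?thesis using s_change[of j] by (elim disjE) simp_all
  qed
  then show ?thesis
  proof (elim disjE conjE)
    assume a: "s (Suc j) mod 3 = (s j + 1) mod 3"
    have b: "(s (Suc j) + 1) mod 3 = (s j + 2) mod 3" 
      using mod_add_cong[OF a refl[of "1 mod 3"]] by simp
    have "va (Suc j) = vb j"
      by (rule trans[OF vx_Suc[OF params] vx_mod[OF a]]) simp
    moreover have "vb (Suc j) = vc j"
      unfolding new_vertex_def by (rule trans[OF vx_Suc[OF params] vx_mod[OF b]]) simp
    ultimately show ?thesis using that(1) a by blast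
  next
    assume a: "s (Suc j) mod 3 = (s j + 2) mod 3" and n: "\<not> turn_left j"
    have b: "(s (Suc j) + 1) mod 3 = s j mod 3"
      using mod_add_cong[OF a refl[of "1 mod 3"]] by simp
    have "va (Suc j) = vc j"
      unfolding new_vertex_def by (rule trans[OF vx_Suc[OF params] vx_mod[OF a]]) simp
    moreover have "vb (Suc j) = va j"
      by (rule trans[OF vx_Suc[OF params] vx_mod[OF b]]) simp
    ultimately show ?thesis using that(2) n by blast
  qed
qed

lemma pt_convex:
  obtains u where "0 < u" "u < 1" "pt j = va j + u *\<^sub>R (vb j - va j)"
  using on_side[of j] unfolding in_segment by (auto simp: algebra_simps)

lemma pt_diff: "pt (Suc j) - pt j = (\<tau> (Suc j) - \<tau> j) *\<^sub>R d"
  by (simp add: algebra_simps)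

lemma cr_pt_diff_left: "cr (pt (Suc j) - pt j) w = (\<tau> (Suc j) - \<tau> j) * cr d w"
  unfolding pt_diff by (simp add: cr_def algebra_simps)

lemma cr_pt_diff_right: "cr e (pt (Suc j) - pt j) = (\<tau> (Suc j) - \<tau> j) * cr e d"
  unfolding pt_diff by (simp add: cr_def algebra_simps)

lemma offset_pt: "offset j = cr d (vc j - pt k)"
  by (simp add: offset_def cr_def algebra_simps)

text \<open>In barycentric coordinates of the triangle \<open>va j, vb j, vc j\<close> the cross products below
  are determinants, i.e. explicit multiples of the orientation.\<close>

lemma step_geometry:
  "0 < orient j * cr (vb j - va j) d"
  "turn_left j \<Longrightarrow> 0 < orient j * offset j"
  "\<not> turn_left j \<Longrightarrow> orient j * offset j < 0"
  "turn_left j \<Longrightarrow> orient j * cr (vc j - vb j) d < 0"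
  "\<not> turn_left j \<Longrightarrow> orient j * cr (va j - vc j) d < 0"
proof -
  let ?a = "va j" and ?b = "vb j" and ?c = "vc j" and ?t = "\<tau> (Suc j) - \<tau> j"
  have t: "0 < ?t" using tau_Suc[of j] by simp
  obtain u where u: "0 < u" "u < 1" "pt j = ?a + u *\<^sub>R (?b - ?a)" by (rule pt_convex)
  have "orient j \<noteq> 0" using apex_height_pos[OF params] by simp
  then have O: "0 < orient j * orient j" using not_real_square_gt_zero by blast
  define K where "K = orient j"
  have K: "cr (?b - ?a) (?c - ?a) = K" unfolding K_def by (rule orient)
  have KK: "0 < K * K" using O by (simp only: K_def)
  have pos: "0 < ?t * y \<Longrightarrow> 0 < y" for y using t by (simp add: zero_less_mult_iff)
  have neg: "?t * y < 0 \<Longrightarrow> y < 0" for y using t by (simp add: mult_less_0_iff)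
  have scaled: "0 < r * (K * K)" if "0 < r" for r using that KK by simp
  have swap: "?t * (K * y) = K * (?t * y)" for y by (simp only: mult.left_commute)
  have "0 < K * cr (?b - ?a) d \<and>
    (turn_left j \<longrightarrow> 0 < K * offset j) \<and> (\<not> turn_left j \<longrightarrow> K * offset j < 0) \<and>
    (turn_left j \<longrightarrow> K * cr (?c - ?b) d < 0) \<and> (\<not> turn_left j \<longrightarrow> K * cr (?a - ?c) d < 0)"
  proof (cases rule: exit_cases[of j])
    case 1
    obtain v where v: "0 < v" "v < 1" "pt (Suc j) = ?b + v *\<^sub>R (?c - ?b)"
      using pt_convex[of "Suc j"] unfolding 1 by blast
    have E1: "?t * cr (?b - ?a) d = v * K"
      unfolding cr_pt_diff_right[symmetric] u(3) v(3) K[symmetric] by (simp add: cr_def algebra_simps)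
    have E2: "?t * offset j = (1 - u) * (1 - v) * K"
      unfolding offset_pt[of j j] cr_pt_diff_left[symmetric] u(3) v(3) K[symmetric] by (simp add: cr_def algebra_simps)
    have E3: "?t * cr (?c - ?b) d = - ((1 - u) * K)"
      unfolding cr_pt_diff_right[symmetric] u(3) v(3) K[symmetric] by (simp add: cr_def algebra_simps)
    have e: "?t * (K * cr (?b - ?a) d) = v * (K * K)" "?t * (K * offset j) = ((1 - u) * (1 - v)) * (K * K)"
       "?t * (K * cr (?c - ?b) d) = - ((1 - u) * (K * K))"
      unfolding swap E1 E2 E3 by (simp_all add: mult_ac)
    have "0 < K * cr (?b - ?a) d" by (rule pos) (simp only: e scaled[of v] v)
    moreover have "0 < K * offset j" by (rule pos) (unfold e, rule scaled, use u v in simp)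
    moreover have "K * cr (?c - ?b) d < 0"
      by (rule neg) (unfold e, use u scaled[of "1 - u"] in simp)
    ultimately show ?thesis using 1(1) by blast
  next
    case 2
    obtain v where v: "0 < v" "v < 1" "pt (Suc j) = ?c + v *\<^sub>R (?a - ?c)"
      using pt_convex[of "Suc j"] unfolding 2 by blast
    have E1: "?t * cr (?b - ?a) d = (1 - v) * K"
      unfolding cr_pt_diff_right[symmetric] u(3) v(3) K[symmetric] by (simp add: cr_def algebra_simps)
    have E2: "?t * offset j = - (u * v * K)"
      unfolding offset_pt[of j j] cr_pt_diff_left[symmetric] u(3) v(3) K[symmetric] by (simp add: cr_def algebra_simps)
    have E3: "?t * cr (?a - ?c) d = - (u * K)"
      unfolding cr_pt_diff_right[symmetric] u(3) v(3) K[symmetric] by (simp add: cr_def algebra_simps)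
    have e: "?t * (K * cr (?b - ?a) d) = (1 - v) * (K * K)" "?t * (K * offset j) = - ((u * v) * (K * K))"
       "?t * (K * cr (?a - ?c) d) = - (u * (K * K))"
      unfolding swap E1 E2 E3 by (simp_all add: mult_ac)
    have "0 < K * cr (?b - ?a) d" by (rule pos) (unfold e, rule scaled, use v in simp)
    moreover have "K * offset j < 0"
      by (rule neg) (unfold e, use u v scaled[of "u * v"] in simp)
    moreover have "K * cr (?a - ?c) d < 0"
      by (rule neg) (unfold e, use u scaled[of u] in simp)
    ultimately show ?thesis using 2(1) by blast
  qed
  then show "0 < orient j * cr (?b - ?a) d"
    "turn_left j \<Longrightarrow> 0 < orient j * offset j"
    "\<not> turn_left j \<Longrightarrow> orient j * offset j < 0"
    "turn_left j \<Longrightarrow> orient j * cr (?c - ?b) d < 0"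
    "\<not> turn_left j \<Longrightarrow> orient j * cr (?a - ?c) d < 0"
    unfolding K_def by blast+
qed

lemma norm_edges: "norm (vb j - va j) \<le> tri_size x" "norm (vc j - vb j) \<le> tri_size x" "norm (va j - vc j) \<le> tri_size x"
  using dist_vx_le[of x s j] by (simp_all add: dist_norm new_vertex_def)

lemma offset_diff: "cr d (vc j - vc i) = offset j - offset i"
  by (simp add: offset_def cr_def algebra_simps)

text \<open>A vertex that the line nearly meets projects onto it after the entry into, and before the
  exit from, the fan of triangles around that vertex.\<close>

lemma new_vertex_after_entry:
  assumes "\<bar>offset j\<bar> * tri_size x < apex_height x"
  shows "\<tau> j < (vc j - P) \<bullet> d"
proof -
  obtain u where u: "0 < u" "u < 1" "pt j = va j + u *\<^sub>R (vb j - va j)" by (rule pt_convex)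
  have "cr (vb j - va j) (vc j - pt j) = orient j"
    unfolding u(3) orient[symmetric] by (simp add: cr_def algebra_simps)
  moreover have "\<bar>cr d (vc j - pt j)\<bar> * norm (vb j - va j) < \<bar>orient j\<bar>"
    unfolding offset_pt[of j j, symmetric] abs_orient
    using norm_edges(1)[of j] assms by (meson abs_ge_zero le_less_trans mult_left_mono)
  ultimately have "0 < (vc j - pt j) \<bullet> d"
    by (rule inner_pos_of_cr[OF unit _ step_geometry(1)])
  also have "(vc j - pt j) \<bullet> d = (vc j - P) \<bullet> d - \<tau> j"
    using unit by (simp add: inner_diff_left inner_add_left norm_eq_1)
  finally show ?thesis by simp
qed

lemma near_vertex_before:
  assumes near: "\<bar>offset i\<bar> * tri_size x < apex_height x" and "i < j"
  shows "vc i \<in> {va j, vb j} \<or> (vc i - P) \<bullet> d < \<tau> j"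
  using \<open>i < j\<close>
proof (induction j)
  case (Suc j)
  \<comment> \<open>Here \<open>e\<close> is the exit edge opposite the vertex \<open>vc i\<close>.
    The line crosses it outwards, so the entry argument applies with \<open>d\<close>
    reversed.\<close>
  have exit: "(vc i - P) \<bullet> d < \<tau> (Suc j)"
    if w: "cr e (vc i - pt (Suc j)) = orient j" "orient j * cr e d < 0" "norm e \<le> tri_size x" for e
  proof -
    have "\<bar>cr (- d) (vc i - pt (Suc j))\<bar> * norm e < \<bar>orient j\<bar>"
      unfolding cr_minus_left abs_minus_cancel offset_pt[of i "Suc j", symmetric] abs_orient
      using w(3) near by (meson abs_ge_zero le_less_trans mult_left_mono)
    then have "0 < (vc i - pt (Suc j)) \<bullet> (- d)"
      using w unit by (intro inner_pos_of_cr[of _ e _ "orient j"]) (auto simp: cr_def algebra_simps)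
    also have "(vc i - pt (Suc j)) \<bullet> (- d) = \<tau> (Suc j) - (vc i - P) \<bullet> d"
      using unit by (simp add: inner_diff_left inner_add_left norm_eq_1)
    finally show ?thesis by simp
  qed
  \<comment> \<open>Either the line is still in the fan of triangles around \<open>vc i\<close>, or
    it has left it for good.\<close>
  have "i = j \<or> vc i \<in> {va j, vb j} \<or> (vc i - P) \<bullet> d < \<tau> j"
    using Suc by (cases "i = j") auto
  then consider "i = j" | "vc i = va j" | "vc i = vb j" | "(vc i - P) \<bullet> d < \<tau> j" by blast
  then show ?case
  proof cases
    case 1
    then show ?thesis by (cases rule: exit_cases[of j]) auto
  next
    case 2
    show ?thesis
    proof (cases rule: exit_cases[of j])
      case 1
      obtain v where v: "0 < v" "v < 1" "pt (Suc j) = vb j + v *\<^sub>R (vc j - vb j)"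
        using pt_convex[of "Suc j"] unfolding 1 by blast
      have "cr (vc j - vb j) (vc i - pt (Suc j)) = orient j"
        unfolding v(3) 2 orient[symmetric] by (simp add: cr_def algebra_simps)
      then show ?thesis using exit step_geometry(4)[OF 1(1)] norm_edges by blast
    qed (use 2 in simp)
  next
    case 3
    show ?thesis
    proof (cases rule: exit_cases[of j])
      case 2
      obtain v where v: "0 < v" "v < 1" "pt (Suc j) = vc j + v *\<^sub>R (va j - vc j)"
        using pt_convex[of "Suc j"] unfolding 2 by blast
      have "cr (va j - vc j) (vc i - pt (Suc j)) = orient j"
        unfolding v(3) 3 orient[symmetric] by (simp add: cr_def algebra_simps)
      then show ?thesis using exit step_geometry(5)[OF 2(1)] norm_edges by blast
    qed (use 3 in simp)
  next
    case 4
    then show ?thesis using tau_Suc[of j] by simp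
  qed
qed simp

text \<open>If \<open>vc i\<close> is still an end of the side crossed at time \<open>j\<close>,
  both vertices belong to copy \<open>j\<close> and their difference, with cross product at most
  \<open>2 * \<eta>\<close> against \<open>d\<close>, is treated directly. Otherwise
  \<open>\<tau> j\<close> separates the two projections.\<close>

lemma near_vertices_ordered:
  assumes "\<bar>offset i\<bar> \<le> \<eta>" "\<bar>offset j\<bar> \<le> \<eta>" "2 * \<eta> * tri_size x < apex_height x" "i < j"
  shows "(vc i - P) \<bullet> d < (vc j - P) \<bullet> d"
proof -
  have L: "0 < tri_size x" using tri_size_ge_1[of x] by simp
  have "\<bar>offset k\<bar> * tri_size x < apex_height x" if "\<bar>offset k\<bar> \<le> \<eta>" for k
  proof -
    have "\<bar>offset k\<bar> * tri_size x \<le> (2 * \<eta>) * tri_size x"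
      using that L by (intro mult_right_mono) auto
    then show ?thesis using assms(3) by linarith
  qed
  then have near: "\<bar>offset i\<bar> * tri_size x < apex_height x" "\<bar>offset j\<bar> * tri_size x < apex_height x"
    using assms by blast+
  consider "vc i \<in> {va j, vb j}" | "(vc i - P) \<bullet> d < \<tau> j"
    using near_vertex_before[OF near(1) \<open>i < j\<close>] by blast
  then show ?thesis
  proof cases
    case 1
    have "cr (vb j - va j) (vc j - vc i) = orient j"
      using 1 unfolding orient[symmetric] by (auto simp: cr_def algebra_simps)
    moreover have "\<bar>cr d (vc j - vc i)\<bar> * norm (vb j - va j) < \<bar>orient j\<bar>"
    proof -
      have "\<bar>cr d (vc j - vc i)\<bar> \<le> 2 * \<eta>" unfolding offset_diff using assms by linarith
      then have "\<bar>cr d (vc j - vc i)\<bar> * norm (vb j - va j) \<le> 2 * \<eta> * tri_size x"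
        using norm_edges(1)[of j] by (intro mult_mono) auto
      then show ?thesis unfolding abs_orient using assms(3) by linarith
    qed
    ultimately have "0 < (vc j - vc i) \<bullet> d"
      by (rule inner_pos_of_cr[OF unit _ step_geometry(1)])
    then show ?thesis by (simp add: inner_diff_left)
  next
    case 2
    then show ?thesis using new_vertex_after_entry[OF near(2)] by linarith
  qed
qed

text \<open>A crossing point is within one side length of both ends of its side, and consecutive
  crossed sides share an end.\<close>

lemma dist_pt_new_vertex: "dist (pt j) (vc j) \<le> 2 * tri_size x"
  and dist_pt_Suc: "dist (pt j) (pt (Suc j)) \<le> 2 * tri_size x"
proof -
  obtain u where u: "0 < u" "u < 1" "pt j = va j + u *\<^sub>R (vb j - va j)" by (rule pt_convex)
  have "norm (u *\<^sub>R (vb j - va j)) \<le> 1 * tri_size x"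
    unfolding norm_scaleR using u norm_edges(1)[of j] by (intro mult_mono) auto
  then have a: "dist (pt j) (va j) \<le> tri_size x" using u by (simp add: dist_norm)
  have "pt j - vb j = - ((1 - u) *\<^sub>R (vb j - va j))" using u by (simp add: algebra_simps)
  then have "norm (pt j - vb j) = \<bar>1 - u\<bar> * norm (vb j - va j)" by (simp only: norm_minus_cancel norm_scaleR)
  also have "\<dots> \<le> 1 * tri_size x"
    using u norm_edges(1)[of j] by (intro mult_mono) auto
  finally have b: "dist (pt j) (vb j) \<le> tri_size x" by (simp add: dist_norm)
  have "dist (va j) (vc j) \<le> tri_size x" using norm_edges(3)[of j] by (simp add: dist_norm)
  with a show "dist (pt j) (vc j) \<le> 2 * tri_size x"
    using dist_triangle[of "pt j" "vc j" "va j"] by linarith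
  obtain v where v: "0 < v" "v < 1" "pt (Suc j) = va (Suc j) + v *\<^sub>R (vb (Suc j) - va (Suc j))" by (rule pt_convex)
  have "norm (v *\<^sub>R (vb (Suc j) - va (Suc j))) \<le> 1 * tri_size x"
    unfolding norm_scaleR using v norm_edges(1)[of "Suc j"] by (intro mult_mono) auto
  then have a': "dist (pt (Suc j)) (va (Suc j)) \<le> tri_size x" using v by (simp add: dist_norm)
  have "pt (Suc j) - vb (Suc j) = - ((1 - v) *\<^sub>R (vb (Suc j) - va (Suc j)))" using v by (simp add: algebra_simps)
  then have "norm (pt (Suc j) - vb (Suc j)) = \<bar>1 - v\<bar> * norm (vb (Suc j) - va (Suc j))"
    by (simp only: norm_minus_cancel norm_scaleR)
  also have "\<dots> \<le> 1 * tri_size x"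
    using v norm_edges(1)[of "Suc j"] by (intro mult_mono) auto
  finally have b': "dist (pt (Suc j)) (vb (Suc j)) \<le> tri_size x" by (simp add: dist_norm)
  show "dist (pt j) (pt (Suc j)) \<le> 2 * tri_size x"
  proof (cases rule: exit_cases[of j])
    case 1
    then show ?thesis using b a' dist_triangle2[of "pt j" "pt (Suc j)" "vb j"] by simp
  next
    case 2
    then show ?thesis using a b' dist_triangle2[of "pt j" "pt (Suc j)" "va j"] by simp
  qed
qed

lemma norm_new_vertex_le: "norm (vc j - P) \<le> 2 * tri_size x * (real j + 1)"
proof -
  have "dist P (pt j) \<le> 2 * tri_size x * real j"
  proof (induction j)
    case 0
    show ?case by (simp add: tau_0)
  next
    case (Suc j)
    then show ?case using dist_pt_Suc[of j] dist_triangle[of P "pt (Suc j)" "pt j"]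
      by (simp add: algebra_simps)
  qed
  then show ?thesis using dist_pt_new_vertex[of j] dist_triangle[of P "vc j" "pt j"]
    by (simp add: dist_norm norm_minus_commute algebra_simps)
qed

text \<open>In the frame of \<open>d\<close> the differences have components at most
  \<open>4 * tri_size x * (n + 1)\<close> along the line and \<open>2 * \<eta>\<close> across it;
  the two products in the expansion give the 16.\<close>

lemma near_collinear_cr_small:
  assumes "\<bar>offset i\<bar> \<le> \<eta>" "\<bar>offset j\<bar> \<le> \<eta>" "\<bar>offset k\<bar> \<le> \<eta>" "i \<le> n" "j \<le> n" "k \<le> n"
  shows "\<bar>cr (vc j - vc i) (vc k - vc i)\<bar> \<le> 16 * \<eta> * tri_size x * (real n + 1)"
proof -
  have L: "0 < tri_size x" using tri_size_ge_1[of x] by simp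
  have nv: "norm (vc l - P) \<le> 2 * tri_size x * (real n + 1)" if "l \<le> n" for l
  proof -
    have "2 * tri_size x * (real l + 1) \<le> 2 * tri_size x * (real n + 1)"
      using that L by (intro mult_left_mono) auto
    then show ?thesis using norm_new_vertex_le[of l] by linarith
  qed
  have nd: "norm (vc l - vc i) \<le> 4 * tri_size x * (real n + 1)" if "l \<le> n" for l
  proof -
    have "norm (vc l - vc i) \<le> norm (vc l - P) + norm (vc i - P)"
      using norm_triangle_ineq4[of "vc l - P" "vc i - P"] by simp
    then show ?thesis using nv[OF that] nv[OF \<open>i \<le> n\<close>] by linarith
  qed
  have i: "\<bar>(vc l - vc i) \<bullet> d\<bar> \<le> 4 * tri_size x * (real n + 1)" if "l \<le> n" for l
    using Cauchy_Schwarz_ineq2[of "vc l - vc i" d] nd[OF that] unit by simp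
  have o: "\<bar>cr d (vc l - vc i)\<bar> \<le> 2 * \<eta>" if "\<bar>offset l\<bar> \<le> \<eta>" for l
    unfolding offset_diff using that assms(1) by linarith
  have "\<bar>((vc j - vc i) \<bullet> d) * cr d (vc k - vc i)\<bar> \<le> 4 * tri_size x * (real n + 1) * (2 * \<eta>)"
    unfolding abs_mult using i[OF assms(5)] o[OF assms(3)] L by (intro mult_mono) auto
  moreover have "\<bar>cr d (vc j - vc i) * ((vc k - vc i) \<bullet> d)\<bar> \<le> (2 * \<eta>) * (4 * tri_size x * (real n + 1))"
    unfolding abs_mult using i[OF assms(6)] o[OF assms(2)] assms(1) by (intro mult_mono) auto
  ultimately show ?thesis
    unfolding cr_expand[OF unit, of "vc j - vc i" "vc k - vc i"] by (simp add: algebra_simps)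
qed

text \<open>Along a straight line through three collinear nearby vertices the sign of the offset is that
  of an affine function, so it changes at most once.\<close>

lemma offset_not_alternating:
  assumes near: "\<bar>offset i\<bar> \<le> \<eta>" "\<bar>offset j\<bar> \<le> \<eta>" "\<bar>offset k\<bar> \<le> \<eta>"
    and \<eta>: "2 * \<eta> * tri_size x < apex_height x" and ij: "i < j" "j < k"
    and col: "cr (vc j - vc i) (vc k - vc i) = 0" and same: "0 < offset i \<longleftrightarrow> 0 < offset k"
  shows "0 < offset j \<longleftrightarrow> 0 < offset i"
proof -
  let ?f = "(vc j - vc i) \<bullet> d" and ?g = "(vc k - vc i) \<bullet> d"
  have f: "0 < ?f" "?f < ?g"
    using near_vertices_ordered[OF near(1,2) \<eta> ij(1)] near_vertices_ordered[OF near(2,3) \<eta> ij(2)]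
    by (simp_all add: inner_diff_left)
  have "?f * (offset k - offset i) = (offset j - offset i) * ?g"
    using col unfolding cr_expand[OF unit, of "vc j - vc i" "vc k - vc i"] offset_diff by simp
  then have e: "offset j * ?g = offset i * (?g - ?f) + offset k * ?f" by (simp add: algebra_simps)
  show ?thesis
  proof (cases "0 < offset i")
    case True
    then have "0 < offset j * ?g" unfolding e using f same by (intro add_pos_pos mult_pos_pos) auto
    then show ?thesis using True f by (simp add: zero_less_mult_iff)
  next
    case False
    then have "offset i * (?g - ?f) \<le> 0" "offset k * ?f \<le> 0"
      using f same by (auto intro!: mult_nonpos_nonneg)
    then have "offset j * ?g \<le> 0" unfolding e by linarith
    then show ?thesis using False f by (simp add: mult_le_0_iff)
  qed
qed

end

section \<open>At most one sign change of the nearby offsets per block\<close>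

context unfolded_line
begin

text \<open>The letters up to \<open>b\<close> act as one isometry common to all vertices of the
  window, leaving prefixes of a word of length \<open>m\<close>.\<close>

lemma vx_shift:
  assumes "b \<le> i" "i \<le> b + m"
  shows "vx x s i q = unfold x (map s [1..<Suc b]) (unf_vertex x (take (i - b) (map s [Suc b..<Suc b + m])) (q mod 3))"
proof -
  have "[1..<Suc i] = [1..<Suc b] @ [Suc b..<Suc i]"
    using upt_add_eq_append[of 1 "Suc b" "i - b"] assms by simp
  moreover have "take (i - b) (map s [Suc b..<Suc b + m]) = map s [Suc b..<Suc i]"
    using assms by (simp only: take_map) (subst take_upt, auto)
  ultimately show ?thesis
    by (simp only: vx_def unf_vertex_def map_append unfold_append tri_vertex_mod)
qed

text \<open>That common isometry changes cross products by a sign only, so the gap known for words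
  read from the start holds in every window.\<close>

lemma generic_collinear_zero:
  assumes gen: "\<forall>t\<in>prefix_triples m. vertex_cr x t = 0 \<or> theta m \<le> \<bar>vertex_cr x t\<bar>"
    and range: "b \<le> i" "i \<le> b + m" "b \<le> j" "j \<le> b + m" "b \<le> k" "k \<le> b + m"
    and small: "\<bar>cr (vc j - vc i) (vc k - vc i)\<bar> < theta m"
  shows "cr (vc j - vc i) (vc k - vc i) = 0"
proof -
  define w where "w = map s [Suc b..<Suc b + m]"
  define t where "t = (take (i - b) w, take (j - b) w, take (k - b) w, (s i + 2) mod 3, (s j + 2) mod 3, (s k + 2) mod 3)"
  have w: "set w \<subseteq> {..<3}" "length w = m" using s_less by (auto simp: w_def)
  have t: "t \<in> prefix_triples m"
    unfolding prefix_triples_def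
    by (rule image_eqI[where x = "(w, i - b, j - b, k - b, (s i + 2) mod 3, (s j + 2) mod 3, (s k + 2) mod 3)"])
      (use w range in \<open>auto simp: t_def\<close>)
  have e: "cr (vc j - vc i) (vc k - vc i) = (-1) ^ b * vertex_cr x t"
    unfolding new_vertex_def vx_shift[OF range(1,2)] vx_shift[OF range(3,4)] vx_shift[OF range(5,6)] cr_unfold
    by (simp add: vertex_cr_def t_def w_def del: upt_Suc)
  have "\<bar>vertex_cr x t\<bar> < theta m" using small by (simp add: e abs_mult)
  then have "vertex_cr x t = 0" using gen t by force
  then show ?thesis by (simp add: e)
qed

text \<open>Any three vertices of the block that are near the line have a cross product below
  \<open>theta m\<close>, hence are exactly collinear. The sign of the offset then cannot change and
  return, so one bit for the first sign and one switching time \<open>T\<close> describe all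
  signs.\<close>

lemma block_code:
  assumes gen: "\<forall>t\<in>prefix_triples m. vertex_cr x t = 0 \<or> theta m \<le> \<bar>vertex_cr x t\<bar>"
    and \<eta>: "2 * \<eta> * tri_size x < apex_height x" "16 * \<eta> * tri_size x * (real n + 1) < theta m"
    and m: "1 \<le> m"
  shows "\<exists>c T. T \<le> n \<and> (\<forall>j<n. j div m = r \<longrightarrow> \<bar>offset j\<bar> \<le> \<eta> \<longrightarrow> (0 < offset j \<longleftrightarrow> (c \<longleftrightarrow> j < T)))"
proof -
  define S where "S = {j. j < n \<and> j div m = r \<and> \<bar>offset j\<bar> \<le> \<eta>}"
  have fS: "finite S" by (simp add: S_def)
  have noalt: "0 < offset j \<longleftrightarrow> 0 < offset i"
    if "i \<in> S" "j \<in> S" "k \<in> S" "i < j" "j < k" "0 < offset i \<longleftrightarrow> 0 < offset k" for i j k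
  proof (rule offset_not_alternating[where \<eta> = \<eta> and k = k])
    have rg: "r * m \<le> l" "l \<le> r * m + m" if "l \<in> S" for l
    proof -
      have "l = r * m + l mod m" using that div_mult_mod_eq[of l m] by (simp add: S_def)
      moreover have "l mod m < m" using m by simp
      ultimately show "r * m \<le> l" "l \<le> r * m + m" by linarith+
    qed
    have near: "\<bar>offset l\<bar> \<le> \<eta>" "l \<le> n" if "l \<in> S" for l using that by (auto simp: S_def)
    have "\<bar>cr (vc j - vc i) (vc k - vc i)\<bar> \<le> 16 * \<eta> * tri_size x * (real n + 1)"
      using that by (intro near_collinear_cr_small near)
    also have "\<dots> < theta m" by (rule \<eta>(2))
    finally show "cr (vc j - vc i) (vc k - vc i) = 0"
      using that by (intro generic_collinear_zero[OF gen, of "r * m"] rg)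
  qed (use that \<eta> in \<open>auto simp: S_def\<close>)
  show ?thesis
  proof (cases "S = {}")
    case True
    then show ?thesis by (intro exI[of _ True] exI[of _ 0]) (auto simp: S_def)
  next
    case False
    define i where "i = Min S"
    have i: "i \<in> S" "\<And>j. j \<in> S \<Longrightarrow> i \<le> j" using False fS by (auto simp: i_def)
    define D where "D = {j \<in> S. (0 < offset j) \<noteq> (0 < offset i)}"
    have fD: "finite D" using fS by (simp add: D_def)
    show ?thesis
    proof (cases "D = {}")
      case True
      \<comment> \<open>Without a sign change the switching time \<open>n\<close> lies beyond every
        index.\<close>
      then show ?thesis
        by (intro exI[of _ "0 < offset i"] exI[of _ n]) (auto simp: S_def D_def)
    next
      case False
      \<comment> \<open>The first index whose sign differs from that of \<open>i\<close>; a later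
        index with the old sign would contradict \<open>noalt\<close>.\<close>
      define T where "T = Min D"
      have T: "T \<in> D" "\<And>j. j \<in> D \<Longrightarrow> T \<le> j" using False fD by (auto simp: T_def)
      have "i < T" using T(1) i(2)[of T] by (cases "i = T") (auto simp: D_def)
      have "0 < offset j \<longleftrightarrow> ((0 < offset i) \<longleftrightarrow> j < T)" if j: "j \<in> S" for j
      proof (cases "j < T")
        case True
        then show ?thesis using T(2)[of j] j by (auto simp: D_def)
      next
        case False
        have "(0 < offset j) \<noteq> (0 < offset i)"
        proof
          assume e: "(0 < offset j) = (0 < offset i)"
          then have "T \<noteq> j" using T(1) by (auto simp: D_def)
          then have "T < j" using False by simp
          then show False using noalt[of i T j] i(1) T(1) j \<open>i < T\<close> e by (auto simp: D_def)
        qed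
        then show ?thesis using False by blast
      qed
      moreover have "T \<le> n" using T(1) by (auto simp: D_def S_def)
      ultimately show ?thesis
        by (intro exI[of _ "0 < offset i"] exI[of _ T]) (auto simp: S_def)
    qed
  qed
qed

end

section \<open>Two nearby lines at their first difference\<close>

lemma opposite_signs:
  fixes K u v :: real
  assumes "0 < K * u" "K * v < 0"
  shows "(0 < u) \<noteq> (0 < v)" "\<bar>u\<bar> \<le> \<bar>u - v\<bar>" "\<bar>v\<bar> \<le> \<bar>u - v\<bar>"
  using assms by (auto simp: zero_less_mult_iff mult_less_0_iff)

text \<open>Up to step \<open>j\<close> both lines run through the same copies, so they face the
  same new vertex and pass it on opposite sides. Each offset is then at most the difference of the
  two, which closeness of the lines makes small.\<close>

lemma lines_diverge:
  assumes l: "unfolded_line x s P d \<tau>" and l': "unfolded_line x s' P' d' \<tau>'"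
    and same: "\<And>i. i \<le> j \<Longrightarrow> s i = s' i" and diff: "s (Suc j) \<noteq> s' (Suc j)"
    and close: "norm (P - P') \<le> \<delta>" "norm (d - d') \<le> \<delta>" and "j < n"
  defines "o1 \<equiv> unfolded_line.offset x s P d j" and "o2 \<equiv> unfolded_line.offset x s' P' d' j"
  shows "(0 < o1) \<noteq> (0 < o2)"
    "\<bar>o1\<bar> \<le> \<delta> * (2 * tri_size x * (real n + 1) + 1)" "\<bar>o2\<bar> \<le> \<delta> * (2 * tri_size x * (real n + 1) + 1)"
proof -
  interpret A: unfolded_line x s P d \<tau> by (rule l)
  interpret B: unfolded_line x s' P' d' \<tau>' by (rule l')
  let ?K = "(-1) ^ j * apex_height x"
  have \<delta>: "0 \<le> \<delta>" using close(1) norm_ge_zero order_trans by blast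
  have c: "new_vertex x s j = new_vertex x s' j"
    unfolding new_vertex_def using same by (simp add: vx_cong[of j s s'])
  have tl: "A.turn_left j \<noteq> B.turn_left j"
  proof -
    have "s j = 0 \<or> s j = 1 \<or> s j = 2" "s (Suc j) = 0 \<or> s (Suc j) = 1 \<or> s (Suc j) = 2"
      "s' (Suc j) = 0 \<or> s' (Suc j) = 1 \<or> s' (Suc j) = 2"
      using A.s_less[of j] A.s_less[of "Suc j"] B.s_less[of "Suc j"] by linarith+
    then show ?thesis using A.s_change[of j] B.s_change[of j] diff same[of j]
      by (elim disjE) simp_all
  qed
  have "0 < ?K * o1 \<and> ?K * o2 < 0 \<or> 0 < ?K * o2 \<and> ?K * o1 < 0"
    using tl A.step_geometry(2,3)[of j] B.step_geometry(2,3)[of j] unfolding o1_def o2_def by blast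
  then have *: "(0 < o1) \<noteq> (0 < o2) \<and> \<bar>o1\<bar> \<le> \<bar>o1 - o2\<bar> \<and> \<bar>o2\<bar> \<le> \<bar>o1 - o2\<bar>"
    using opposite_signs[of ?K o1 o2] opposite_signs[of ?K o2 o1] by (auto simp: abs_minus_commute)
  \<comment> \<open>A direction error, with the distance from \<open>P\<close> to the vertex as
    lever arm, and a position error.\<close>
  have "o1 - o2 = cr (d - d') (new_vertex x s j - P) + cr d' (P' - P)"
    unfolding o1_def o2_def A.offset_def B.offset_def c by (simp add: cr_def algebra_simps)
  moreover have "\<bar>cr (d - d') (new_vertex x s j - P)\<bar> \<le> \<delta> * (2 * tri_size x * (real n + 1))"
  proof -
    have "2 * tri_size x * (real j + 1) \<le> 2 * tri_size x * (real n + 1)"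
      using \<open>j < n\<close> tri_size_ge_1[of x] by (intro mult_left_mono) auto
    then have "norm (new_vertex x s j - P) \<le> 2 * tri_size x * (real n + 1)"
      using A.norm_new_vertex_le[of j] by linarith
    then have "norm (d - d') * norm (new_vertex x s j - P) \<le> \<delta> * (2 * tri_size x * (real n + 1))"
      using close \<delta> by (intro mult_mono) auto
    then show ?thesis using abs_cr_le order_trans by blast
  qed
  moreover have "\<bar>cr d' (P' - P)\<bar> \<le> \<delta>"
    using abs_cr_le[of d' "P' - P"] B.unit close(1) by (simp add: norm_minus_commute)
  ultimately have "\<bar>o1 - o2\<bar> \<le> \<delta> * (2 * tri_size x * (real n + 1) + 1)"
    by (simp add: algebra_simps)
  with * show "(0 < o1) \<noteq> (0 < o2)"
    "\<bar>o1\<bar> \<le> \<delta> * (2 * tri_size x * (real n + 1) + 1)" "\<bar>o2\<bar> \<le> \<delta> * (2 * tri_size x * (real n + 1) + 1)"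
    by linarith+
qed

section \<open>From billiard orbits to straight lines\<close>

lemma side_refl_involution: "side_refl x a (side_refl x a z) = z"
proof -
  consider "a mod 3 = 0" | "a mod 3 = 1" | "a mod 3 = 2" by linarith
  then show ?thesis
    by cases (simp_all add: side_refl_def cis_cnj mult.assoc[symmetric] cis_mult)
qed

lemma tri_side_eq: "side (tri_vertex \<alpha> \<beta>) a = open_segment (tri_vertex \<alpha> \<beta> a) (tri_vertex \<alpha> \<beta> (a + 1))"
  using tri_vertex_mod[of \<alpha> \<beta> "a + 1"] by (simp add: side_def)

text \<open>Points of side \<open>a\<close> have cross product zero with that side, points of the
  other open sides a positive one. This ensures that the initial direction of an orbit is
  nonzero.\<close>

lemma tri_sides_disjoint:
  assumes x: "x \<in> tri_params" and ab: "a < 3" "b < 3" "a \<noteq> b"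
    and p: "p \<in> side (tri_vertex (fst x) (snd x)) a" and q: "q \<in> side (tri_vertex (fst x) (snd x)) b"
  shows "p \<noteq> q"
proof -
  let ?V = "tri_vertex (fst x) (snd x)"
  have V: "?V q = ?V r" if "q mod 3 = r mod 3" for q r
    using that tri_vertex_mod[of "fst x" "snd x" q] tri_vertex_mod[of "fst x" "snd x" r] by simp
  obtain u where u: "p = ?V a + u *\<^sub>R (?V (a + 1) - ?V a)"
    using p unfolding tri_side_eq in_segment by (auto simp: algebra_simps)
  obtain v where v: "0 < v" "v < 1" "q = ?V b + v *\<^sub>R (?V (b + 1) - ?V b)"
    using q unfolding tri_side_eq in_segment by (auto simp: algebra_simps)
  have h: "cr (?V (a + 1) - ?V a) (?V (a + 2) - ?V a) = apex_height x"
    unfolding apex_height_def by (rule cr_tri_vertex)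
  have p0: "cr (?V (a + 1) - ?V a) (p - ?V a) = 0" by (simp add: u cr_def algebra_simps)
  have "b mod 3 = (a + 1) mod 3 \<and> (b + 1) mod 3 = (a + 2) mod 3 \<or> b mod 3 = (a + 2) mod 3 \<and> (b + 1) mod 3 = a mod 3"
  proof -
    have "a = 0 \<or> a = 1 \<or> a = 2" "b = 0 \<or> b = 1 \<or> b = 2" using ab by linarith+
    then show ?thesis using ab by (elim disjE) simp_all
  qed
  then consider "?V b = ?V (a + 1)" "?V (b + 1) = ?V (a + 2)" | "?V b = ?V (a + 2)" "?V (b + 1) = ?V a"
    using V by blast
  then have "cr (?V (a + 1) - ?V a) (q - ?V a) \<noteq> 0"
  proof cases
    case 1
    have "cr (?V (a + 1) - ?V a) (q - ?V a) = v * apex_height x"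
      unfolding v(3) 1 h[symmetric] by (simp add: cr_def algebra_simps)
    then show ?thesis using v apex_height_pos[OF x] by simp
  next
    case 2
    have "cr (?V (a + 1) - ?V a) (q - ?V a) = (1 - v) * apex_height x"
      unfolding v(3) 2 h[symmetric] by (simp add: cr_def algebra_simps)
    then show ?thesis using v apex_height_pos[OF x] by simp
  qed
  then show ?thesis using p0 by auto
qed

lemma unfold_Suc: "unfold x (map s [1..<Suc (Suc j)]) z = unfold x (map s [1..<Suc j]) (side_refl x (s (Suc j)) z)"
  by (simp add: unfold_append unfold_Cons)

lemma norm_side_le: "p \<in> side (tri_vertex (fst x) (snd x)) a \<Longrightarrow> norm p \<le> tri_size x"
proof -
  assume "p \<in> side (tri_vertex (fst x) (snd x)) a"
  then have "p \<in> closed_segment (tri_vertex (fst x) (snd x) a) (tri_vertex (fst x) (snd x) (a + 1))"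
    unfolding tri_side_eq by (rule open_closed_segment)
  also have "\<dots> \<subseteq> cball 0 (tri_size x)"
    by (intro closed_segment_subset) (use norm_tri_vertex_le[of x] in auto)
  finally show ?thesis by simp
qed

text \<open>The unfolded bounce points \<open>Q j\<close> have successive differences that are
  positive multiples of one another, by the reflection law; hence they lie in order on one
  ray.\<close>

lemma billiard_unfolded_line:
  assumes x: "x \<in> tri_params" and orbit: "periodic_billiard_orbit (tri_vertex (fst x) (snd x)) k p s"
  obtains \<tau> where "unfolded_line x s (p 0) (sgn (p 1 - p 0)) \<tau>"
proof -
  let ?V = "tri_vertex (fst x) (snd x)"
  define U where "U j = unfold x (map s [1..<Suc j])" for j
  define Q where "Q j = U j (p j)" for j
  have s3: "s j < 3" and ps: "p j \<in> side ?V (s j)" and ss: "s (Suc j) \<noteq> s j" for j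
    using orbit unfolding periodic_billiard_orbit_def by blast+
  have refl: "\<exists>t>0. p (Suc (Suc j)) - p (Suc j) =
      t *\<^sub>R (side_refl x (s (Suc j)) (p (Suc j)) - side_refl x (s (Suc j)) (p j))" for j
  proof -
    obtain t where t: "t > 0" "p (j + 2) - p (j + 1) =
          t *\<^sub>R (line_reflect (?V ((s (j + 1) + 1) mod 3) - ?V (s (j + 1))) (p (j + 1) - p j))"
      using orbit unfolding periodic_billiard_orbit_def by blast
    have "p (Suc (Suc j)) - p (Suc j) =
          t *\<^sub>R (line_reflect (?V (s (Suc j) + 1) - ?V (s (Suc j))) (p (Suc j) - p j))"
      using t(2) unfolding tri_vertex_mod by simp
    then show ?thesis using t(1) side_refl_line_reflect[OF x] by metis
  qed
  have U_Suc: "U (Suc j) z = U j (side_refl x (s (Suc j)) z)" for j z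
    unfolding U_def by (rule unfold_Suc)
  \<comment> \<open>A bounce point is fixed by the reflection in its own side, so it has the same
    place in the copies before and after the crossing.\<close>
  have Q_Suc: "Q (Suc j) = U j (p (Suc j))" for j
    unfolding Q_def U_Suc using side_refl_fix_segment[OF x ps[of "Suc j"]] by simp
  have step: "\<exists>t>0. Q (Suc (Suc j)) - Q (Suc j) = t *\<^sub>R (Q (Suc j) - Q j)" for j
  proof -
    let ?R = "side_refl x (s (Suc j))"
    obtain t where t: "t > 0" "p (Suc (Suc j)) - p (Suc j) = t *\<^sub>R (?R (p (Suc j)) - ?R (p j))"
      using refl by blast
    \<comment> \<open>Reflecting both sides of the law once more removes the reflection from the
      incoming segment: seen in the next copy, the outgoing segment continues it straight.\<close>
    from unfold_diff_scaleR[OF t(2), of x "[s (Suc j)]"]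
    have "?R (p (Suc (Suc j))) - ?R (p (Suc j)) = t *\<^sub>R (p (Suc j) - p j)"
      by (simp add: unfold_Cons side_refl_involution)
    from unfold_diff_scaleR[OF this, of x "map s [1..<Suc j]"]
    have "Q (Suc (Suc j)) - Q (Suc j) = t *\<^sub>R (Q (Suc j) - Q j)"
      unfolding U_def[symmetric] using Q_Suc[of j] Q_Suc[of "Suc j"] by (simp add: U_Suc Q_def)
    then show ?thesis using t(1) by blast
  qed
  have Q0: "Q 0 = p 0" by (simp add: Q_def U_def)
  have Q1: "Q 1 = p 1" using Q_Suc[of 0] by (simp add: U_def)
  have "\<exists>r>0. Q (Suc j) - Q j = r *\<^sub>R (p 1 - p 0)" for j
  proof (induction j)
    case 0
    show ?case using Q0 Q1 by (intro exI[of _ 1]) simp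
  next
    case (Suc j)
    then obtain r where r: "r > 0" "Q (Suc j) - Q j = r *\<^sub>R (p 1 - p 0)" by blast
    obtain t where t: "t > 0" "Q (Suc (Suc j)) - Q (Suc j) = t *\<^sub>R (Q (Suc j) - Q j)" using step by blast
    show ?case using r t by (intro exI[of _ "t * r"]) simp
  qed
  then obtain r where r: "\<And>j. 0 < r j" "\<And>j. Q (Suc j) - Q j = r j *\<^sub>R (p 1 - p 0)" by metis
  have ne: "p 1 - p 0 \<noteq> 0"
    using tri_sides_disjoint[OF x s3[of 1] s3[of 0] _ ps[of 1] ps[of 0]] ss[of 0] by auto
  \<comment> \<open>Arc length up to crossing \<open>j\<close>, as \<open>r i\<close> measures
    segment \<open>i\<close> in units of the first one.\<close>
  define \<tau> where "\<tau> j = (\<Sum>i<j. r i * norm (p 1 - p 0))" for j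
  have Q\<tau>: "Q j = p 0 + \<tau> j *\<^sub>R sgn (p 1 - p 0)" for j
  proof (induction j)
    case (Suc j)
    have "Q (Suc j) = Q j + r j *\<^sub>R (p 1 - p 0)" using r(2)[of j] by (simp add: algebra_simps)
    also have "r j *\<^sub>R (p 1 - p 0) = (r j * norm (p 1 - p 0)) *\<^sub>R sgn (p 1 - p 0)"
      using ne by (simp add: sgn_div_norm)
    finally show ?case by (simp add: Suc \<tau>_def scaleR_add_left)
  qed (simp add: Q0 \<tau>_def)
  have on: "Q j \<in> open_segment (vx x s j (s j)) (vx x s j (s j + 1))" for j
  proof -
    obtain u where u: "0 < u" "u < 1" "?V (s j) \<noteq> ?V (s j + 1)" "p j = (1 - u) *\<^sub>R ?V (s j) + u *\<^sub>R ?V (s j + 1)"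
      using ps[of j] unfolding tri_side_eq in_segment by blast
    have "p j - ?V (s j) = u *\<^sub>R (?V (s j + 1) - ?V (s j))" by (simp add: u(4) algebra_simps)
    from unfold_diff_scaleR[OF this, of x "map s [1..<Suc j]"]
    have "Q j - vx x s j (s j) = u *\<^sub>R (vx x s j (s j + 1) - vx x s j (s j))"
      unfolding Q_def U_def vx_def unf_vertex_def .
    then have "Q j = (1 - u) *\<^sub>R vx x s j (s j) + u *\<^sub>R vx x s j (s j + 1)"
      by (simp add: algebra_simps)
    moreover have "vx x s j (s j) \<noteq> vx x s j (s j + 1)"
      using u(3) dist_unfold[of x "map s [1..<Suc j]" "?V (s j)" "?V (s j + 1)"]
      unfolding vx_def unf_vertex_def by (metis dist_eq_0_iff)
    ultimately show ?thesis using u(1,2) by (auto simp: in_segment)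
  qed
  have "unfolded_line x s (p 0) (sgn (p 1 - p 0)) \<tau>"
  proof
    show "norm (sgn (p 1 - p 0)) = 1" using ne by (simp add: norm_sgn)
    show "\<tau> 0 = 0" by (simp add: \<tau>_def)
    show "\<tau> j < \<tau> (Suc j)" for j using r(1)[of j] ne by (simp add: \<tau>_def)
    show "p 0 + \<tau> j *\<^sub>R sgn (p 1 - p 0) \<in> open_segment (vx x s j (s j)) (vx x s j (s j + 1))" for j
      using on[of j] by (simp only: Q\<tau>)
  qed (use x s3 ss in auto)
  then show ?thesis by (rule that)
qed

section \<open>Counting combinatorial types\<close>

text \<open>An object may have many codes; it suffices that no code serves two objects, since a
  choice of codes is then injective.\<close>

lemma card_le_of_injective_relation:
  assumes "finite C" "\<And>a. a \<in> A \<Longrightarrow> \<exists>c\<in>C. R a c" "\<And>a b c. R a c \<Longrightarrow> R b c \<Longrightarrow> a = b"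
  shows "card A \<le> card C"
proof -
  obtain f where f: "\<And>a. a \<in> A \<Longrightarrow> f a \<in> C \<and> R a (f a)" using assms(2) by metis
  have "inj_on f A" using f assms(3) by (metis inj_onI)
  then show ?thesis using f assms(1) by (intro card_inj_on_le[of f]) auto
qed

definition grid :: "real \<Rightarrow> complex \<Rightarrow> int \<times> int" where
  "grid r z = (\<lfloor>Re z / r\<rfloor>, \<lfloor>Im z / r\<rfloor>)"

lemma grid_close:
  assumes "0 < r" "grid r z = grid r w"
  shows "norm (z - w) \<le> 2 * r"
proof -
  have "\<bar>a - b\<bar> \<le> r" if "\<lfloor>a / r\<rfloor> = \<lfloor>b / r\<rfloor>" for a b
  proof -
    have "\<bar>a / r - b / r\<bar> < 1" using that by linarith
    then have "\<bar>(a - b) / r\<bar> < 1" by (simp add: diff_divide_distrib)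
    then show ?thesis using assms(1) by (simp add: abs_divide)
  qed
  then have "\<bar>Re z - Re w\<bar> \<le> r" "\<bar>Im z - Im w\<bar> \<le> r" using assms(2) by (simp_all add: grid_def)
  then show ?thesis using cmod_le[of "z - w"] by simp
qed

lemma grid_bounded:
  assumes "0 < r" "norm z \<le> L" "L / r \<le> real N"
  shows "grid r z \<in> {- int N..int N} \<times> {- int N..int N}"
proof -
  have "\<lfloor>a / r\<rfloor> \<in> {- int N..int N}" if "\<bar>a\<bar> \<le> L" for a
  proof -
    have "\<bar>a / r\<bar> \<le> L / r" using that assms(1) by (simp add: divide_right_mono)
    then have "\<bar>a / r\<bar> \<le> real N" using assms(3) by linarith
    then have "- real N \<le> a / r" "a / r \<le> real N" by linarith+
    then have "- int N \<le> \<lfloor>a / r\<rfloor>" "\<lfloor>a / r\<rfloor> \<le> int N" by linarith+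
    then show ?thesis by simp
  qed
  moreover have "\<bar>Re z\<bar> \<le> L" "\<bar>Im z\<bar> \<le> L"
    using assms(2) abs_Re_le_cmod[of z] abs_Im_le_cmod[of z] by linarith+
  ultimately show ?thesis by (simp only: grid_def mem_Times_iff fst_conv snd_conv)
qed

text \<open>A code consists of the period, the first side, the grid cells of initial point and
  direction, and one bit and switching time per block. It determines the side sequence: at a first
  difference both lines would nearly meet a vertex on opposite sides, while the code prescribes one
  sign.\<close>

lemma Per_le_codes:
  assumes x: "x \<in> tri_params" and m: "1 \<le> m" and \<delta>: "0 < \<delta>"
    and gen: "\<forall>t\<in>prefix_triples m. vertex_cr x t = 0 \<or> theta m \<le> \<bar>vertex_cr x t\<bar>"
    and \<eta>: "\<eta> = \<delta> * (2 * tri_size x * (real n + 1) + 1)"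
    and \<eta>_small: "2 * \<eta> * tri_size x < apex_height x" "16 * \<eta> * tri_size x * (real n + 1) < theta m"
    and N: "2 * tri_size x / \<delta> \<le> real N"
  shows "Per n (tri_vertex (fst x) (snd x)) \<le>
     (n + 1) * (3 * ((2 * N + 1) ^ 4 * (2 * (n + 1)) ^ (n div m + 1)))"
proof -
  let ?V = "tri_vertex (fst x) (snd x)"
  \<comment> \<open>Members of one cell of size \<open>r\<close> are at distance at most
    \<open>2 * r\<close>.\<close>
  define r where "r = \<delta> / 2"
  have r: "0 < r" using \<delta> by (simp add: r_def)
  have N': "tri_size x / r \<le> real N" using N by (simp add: r_def mult.commute)
  define I where "I = {- int N..int N} \<times> {- int N..int N}"
  define C where "C = {..n} \<times> {..<3::nat} \<times> I \<times> I \<times> (\<Pi>\<^sub>E i\<in>{..n div m}. (UNIV :: bool set) \<times> {..n})"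
  define R where "R c y \<longleftrightarrow> (\<exists>k s P d \<tau> B. k \<le> n \<and> c = cyclic_class (map s [0..<k]) \<and>
     unfolded_line x s P d \<tau> \<and> y = (k, s 0, grid r P, grid r d, B) \<and>
     (\<forall>j<n. \<bar>unfolded_line.offset x s P d j\<bar> \<le> \<eta> \<longrightarrow>
        (0 < unfolded_line.offset x s P d j \<longleftrightarrow> (fst (B (j div m)) \<longleftrightarrow> j < snd (B (j div m))))))"
    for c and y :: "nat \<times> nat \<times> (int \<times> int) \<times> (int \<times> int) \<times> (nat \<Rightarrow> bool \<times> nat)"
  have "Per n ?V \<le> card C"
    unfolding Per_def
  proof (rule card_le_of_injective_relation[where R = R])
    show "finite C" unfolding C_def I_def by (intro finite_cartesian_product finite_PiE) auto
  next
    fix c assume "c \<in> {cyclic_class (map s [0..<k]) |k p s. k \<le> n \<and> periodic_billiard_orbit ?V k p s}"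
    then obtain k p s where c: "c = cyclic_class (map s [0..<k])" "k \<le> n" and orbit: "periodic_billiard_orbit ?V k p s"
      by blast
    define d where "d = sgn (p 1 - p 0)"
    obtain \<tau> where line: "unfolded_line x s (p 0) d \<tau>"
      using billiard_unfolded_line[OF x orbit] unfolding d_def by blast
    then interpret unfolded_line x s "p 0" d \<tau> .
    have "\<forall>q. \<exists>b. snd b \<le> n \<and> (\<forall>j<n. j div m = q \<longrightarrow> \<bar>offset j\<bar> \<le> \<eta> \<longrightarrow> (0 < offset j \<longleftrightarrow> (fst b \<longleftrightarrow> j < snd b)))"
      using block_code[OF gen \<eta>_small m] by (metis fst_conv snd_conv)
    then obtain b where b: "\<And>q. snd (b q) \<le> n"
      "\<And>j. j < n \<Longrightarrow> \<bar>offset j\<bar> \<le> \<eta> \<Longrightarrow> (0 < offset j \<longleftrightarrow> (fst (b (j div m)) \<longleftrightarrow> j < snd (b (j div m))))"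
      by metis
    \<comment> \<open>Restriction yields an element of the extensional product; every
      \<open>j < n\<close> has its block number in the retained range.\<close>
    define B where "B = restrict b {..n div m}"
    have Bb: "B (j div m) = b (j div m)" if "j < n" for j
      using that by (simp add: B_def div_le_mono)
    have "p 0 \<in> side ?V (s 0)" using orbit unfolding periodic_billiard_orbit_def by blast
    then have "norm (p 0) \<le> tri_size x" by (rule norm_side_le)
    then have "grid r (p 0) \<in> I" unfolding I_def using grid_bounded[OF r _ N'] by blast
    moreover have "grid r d \<in> I" unfolding I_def using grid_bounded[OF r _ N', of d] unit tri_size_ge_1[of x] by simp
    moreover have "B \<in> (\<Pi>\<^sub>E i\<in>{..n div m}. (UNIV :: bool set) \<times> {..n})"
      using b(1) by (auto simp: B_def mem_Times_iff)
    ultimately have "(k, s 0, grid r (p 0), grid r d, B) \<in> C"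
      using c(2) s_less[of 0] by (simp add: C_def)
    moreover have "R c (k, s 0, grid r (p 0), grid r d, B)"
      unfolding R_def using c line b(2) Bb by (intro exI[of _ k] exI[of _ s] exI[of _ "p 0"] exI[of _ d] exI[of _ \<tau>] exI[of _ B]) simp
    ultimately show "\<exists>y\<in>C. R c y" by blast
  next
    fix c c' y assume "R c y" "R c' y"
    then obtain k s P d \<tau> B s' P' d' \<tau>' where
      c: "k \<le> n" "c = cyclic_class (map s [0..<k])" "c' = cyclic_class (map s' [0..<k])"
      and l: "unfolded_line x s P d \<tau>" "unfolded_line x s' P' d' \<tau>'"
      and g: "s 0 = s' 0" "grid r P = grid r P'" "grid r d = grid r d'"
      and B: "\<And>j. j < n \<Longrightarrow> \<bar>unfolded_line.offset x s P d j\<bar> \<le> \<eta> \<Longrightarrow>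
         (0 < unfolded_line.offset x s P d j \<longleftrightarrow> (fst (B (j div m)) \<longleftrightarrow> j < snd (B (j div m))))"
      and B': "\<And>j. j < n \<Longrightarrow> \<bar>unfolded_line.offset x s' P' d' j\<bar> \<le> \<eta> \<Longrightarrow>
         (0 < unfolded_line.offset x s' P' d' j \<longleftrightarrow> (fst (B (j div m)) \<longleftrightarrow> j < snd (B (j div m))))"
      unfolding R_def by blast
    have close: "norm (P - P') \<le> \<delta>" "norm (d - d') \<le> \<delta>"
      using grid_close[OF r g(2)] grid_close[OF r g(3)] by (simp_all add: r_def)
    have "s i = s' i" if "i \<le> n" for i
      using that
    proof (induction i rule: less_induct)
      case (less i)
      show ?case
      proof (cases i)
        case 0
        then show ?thesis using g(1) by simp
      next
        case (Suc j)
        show ?thesis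
        proof (rule ccontr)
          assume ne: "s i \<noteq> s' i"
          have same: "s q = s' q" if "q \<le> j" for q using less that Suc by simp
          have "j < n" using Suc less.prems by simp
          \<comment> \<open>Both offsets are small with opposite signs, yet
            \<open>B (j div m)\<close> fixes the sign at index \<open>j\<close> for either
            line.\<close>
          note div = lines_diverge[OF l same _ close \<open>j < n\<close>, folded \<eta>]
          show False using div ne Suc B[OF \<open>j < n\<close>] B'[OF \<open>j < n\<close>] by blast
        qed
      qed
    qed
    then have "map s [0..<k] = map s' [0..<k]" using c(1) by (intro map_cong) auto
    then show "c = c'" by (simp only: c)
  qed
  also have "card C = (n + 1) * (3 * ((2 * N + 1) ^ 4 * (2 * (n + 1)) ^ (n div m + 1)))"
  proof -
    have "card I = (2 * N + 1) * (2 * N + 1)"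
      by (simp add: I_def card_cartesian_product) (simp add: nat_add_distrib nat_mult_distrib)
    moreover have "card (\<Pi>\<^sub>E i\<in>{..n div m}. (UNIV :: bool set) \<times> {..n}) = (2 * (n + 1)) ^ (n div m + 1)"
      by (simp only: card_PiE finite_atMost prod_constant card_cartesian_product card_UNIV_bool card_atMost Suc_eq_plus1)
    moreover have "(2 * N + 1) ^ 4 = ((2 * N + 1) * (2 * N + 1)) * ((2 * N + 1) * (2 * N + 1))"
      by (simp only: power4_eq_xxxx mult.assoc)
    ultimately show ?thesis
      by (simp only: C_def card_cartesian_product card_atMost card_lessThan Suc_eq_plus1 mult.assoc)
  qed
  finally show ?thesis .
qed

section \<open>Choice of parameters and asymptotics\<close>

lemma theta_eq: "theta m = exp (- ((16 * real m + 8) * real m powr (3/2))) / 8"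
  by (simp add: theta_def rho_def exp_of_nat_mult[symmetric] algebra_simps)

text \<open>The grid contributes an exponent of order \<open>n powr (5/7)\<close>, as 2/7 times 5/2
  is 5/7, and the block codes one of order \<open>n powr (5/7) * ln n\<close>. Both are negligible
  against \<open>n powr 0.73\<close>.\<close>

lemma code_count_bound:
  fixes K :: real
  assumes "0 < K"
  shows "\<forall>\<^sub>F n::nat in sequentially.
    3 * (real n + 1) * (K * (real n + 1)\<^sup>2 * exp ((16 * (real n powr (2/7) + 1) + 8) * (real n powr (2/7) + 1) powr (3/2)) + 3) ^ 4
      * exp ((real n powr (5/7) + 1) * ln (2 * (real n + 1))) \<le> exp (real n powr 0.73)"
  using assms by real_asymp

lemma filterlim_block_length: "filterlim (\<lambda>n. nat \<lceil>real n powr (2/7)\<rceil>) sequentially sequentially"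
  unfolding filterlim_at_top
proof
  fix Z :: nat
  have "filterlim (\<lambda>n::nat. real n powr (2/7)) at_top sequentially" by real_asymp
  then have "\<forall>\<^sub>F n::nat in sequentially. real Z \<le> real n powr (2/7)" by (simp add: filterlim_at_top)
  then show "\<forall>\<^sub>F n in sequentially. Z \<le> nat \<lceil>real n powr (2/7)\<rceil>"
    by eventually_elim linarith
qed

lemma Per_subexponential:
  assumes x: "x \<in> tri_params"
    and gen: "\<forall>\<^sub>F m in sequentially. \<forall>t\<in>prefix_triples m. vertex_cr x t = 0 \<or> theta m \<le> \<bar>vertex_cr x t\<bar>"
  shows "\<forall>\<^sub>F n in sequentially. real (Per n (tri_vertex (fst x) (snd x))) \<le> exp (real n powr 0.73)"
proof -
  define L where "L = tri_size x"
  have L: "1 \<le> L" unfolding L_def by (rule tri_size_ge_1)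
  define m where "m n = nat \<lceil>real n powr (2/7)\<rceil>" for n
  \<comment> \<open>The product of 800, from \<open>4 * L / \<delta>\<close>, and 8, from
    \<open>inverse (theta (m n))\<close>.\<close>
  define K where "K = 6400 * L ^ 3"
  have K: "0 < K" using L by (simp add: K_def)
  have mlim: "filterlim m sequentially sequentially"
    unfolding m_def[abs_def] by (rule filterlim_block_length)
  have "\<forall>\<^sub>F m in sequentially. exp (- ((16 * real m + 8) * real m powr (3/2))) / 8 < apex_height x"
  proof (rule order_tendstoD(2)[OF _ apex_height_pos[OF x]])
    show "(\<lambda>m. exp (- ((16 * real m + 8) * real m powr (3/2))) / 8) \<longlonglongrightarrow> 0" by real_asymp
  qed
  then have "\<forall>\<^sub>F m in sequentially. theta m < apex_height x" by (simp only: theta_eq)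
  from eventually_compose_filterlim[OF this mlim] eventually_compose_filterlim[OF gen mlim]
    eventually_ge_at_top[of 1] code_count_bound[OF K]
  show ?thesis
  proof eventually_elim
    case (elim n)
    \<comment> \<open>Bounds the rounded block length from above, as needed for
      \<open>inverse (theta (m n))\<close>; the number of blocks uses the bound from below.\<close>
    define \<mu> where "\<mu> = real n powr (2/7) + 1"
    define N' where "N' = real n + 1"
    have N': "1 \<le> N'" by (simp add: N'_def)
    have n1: "1 \<le> real n" using elim(3) by simp
    then have pw: "1 \<le> real n powr (2/7)" by (simp add: ge_one_powr_ge_zero)
    have m_ge: "real n powr (2/7) \<le> real (m n)" unfolding m_def by linarith
    have m_le: "real (m n) \<le> \<mu>" unfolding m_def \<mu>_def using pw by linarith
    have m1: "1 \<le> m n" using m_ge pw by linarith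
    \<comment> \<open>Since \<open>\<eta> \<le> 3 * \<delta> * L * N'\<close>, the divisor makes
      \<open>16 * \<eta> * L * N'\<close> at most 48/200 of \<open>theta (m n)\<close> and
      \<open>2 * \<eta> * L\<close> at most 6/200 of it, which is also below the apex
      height.\<close>
    define \<delta> where "\<delta> = theta (m n) / (200 * L\<^sup>2 * N'\<^sup>2)"
    have \<delta>: "0 < \<delta>" using theta_pos[of "m n"] L N' by (simp add: \<delta>_def)
    have \<delta>\<theta>: "\<delta> * (200 * L\<^sup>2 * N'\<^sup>2) = theta (m n)" using L N' by (simp add: \<delta>_def)
    define \<eta> where "\<eta> = \<delta> * (2 * L * N' + 1)"
    have LN: "1 \<le> L * N'" using mult_mono[OF L N'] L by simp
    have "\<eta> \<le> \<delta> * (3 * (L * N'))" unfolding \<eta>_def using \<delta> LN by (intro mult_left_mono) auto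
    then have "\<eta> * (L * N') \<le> \<delta> * (3 * (L * N')) * (L * N')" using LN by (intro mult_right_mono) auto
    also have "\<dots> = 3 / 200 * theta (m n)" unfolding \<delta>\<theta>[symmetric] by (simp add: power2_eq_square)
    finally have \<eta>LN: "\<eta> * (L * N') \<le> 3 / 200 * theta (m n)" .
    have \<eta>0: "0 \<le> \<eta>" using \<delta> LN by (simp add: \<eta>_def)
    have "\<eta> * L \<le> \<eta> * (L * N')" using \<eta>0 L N' mult_left_mono[of 1 N' L] by (intro mult_left_mono) auto
    then have s1: "2 * \<eta> * L < apex_height x"
      using \<eta>LN elim(1) theta_pos[of "m n"] by linarith
    have s2: "16 * \<eta> * L * N' < theta (m n)"
      using \<eta>LN theta_pos[of "m n"] by (simp add: mult.assoc)
    define N where "N = nat \<lceil>2 * L / \<delta>\<rceil>"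
    have N_ge: "2 * L / \<delta> \<le> real N" unfolding N_def by linarith
    have "0 \<le> 2 * L / \<delta>" using L \<delta> by simp
    then have N_le: "real N \<le> 2 * L / \<delta> + 1" unfolding N_def by linarith
    have "inverse (theta (m n)) = 8 * exp ((16 * real (m n) + 8) * real (m n) powr (3/2))"
    proof -
      have "inverse (exp (- X) / 8) = 8 * exp X" for X :: real by (simp add: exp_minus field_simps)
      then show ?thesis unfolding theta_eq .
    qed
    also have "\<dots> \<le> 8 * exp ((16 * \<mu> + 8) * \<mu> powr (3/2))"
      using m_le by (intro mult_left_mono iffD2[OF exp_le_cancel_iff] mult_mono powr_mono2) auto
    finally have inv: "inverse (theta (m n)) \<le> 8 * exp ((16 * \<mu> + 8) * \<mu> powr (3/2))" .
    have "2 * real N + 1 \<le> 4 * L / \<delta> + 3" using N_le by simp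
    also have "4 * L / \<delta> = 800 * L ^ 3 * N'\<^sup>2 * inverse (theta (m n))"
      using L N' by (simp add: \<delta>_def field_simps power2_eq_square power3_eq_cube)
    also have "\<dots> \<le> 800 * L ^ 3 * N'\<^sup>2 * (8 * exp ((16 * \<mu> + 8) * \<mu> powr (3/2)))"
      using inv L by (intro mult_left_mono) auto
    finally have base: "2 * real N + 1 \<le> K * (real n + 1)\<^sup>2 * exp ((16 * \<mu> + 8) * \<mu> powr (3/2)) + 3"
      by (simp add: K_def N'_def mult_ac)
    have "real (n div m n) \<le> real n / real (m n)" by (rule of_nat_div_le_of_nat)
    also have "\<dots> \<le> real n / real n powr (2/7)"
      using m_ge pw by (intro divide_left_mono mult_pos_pos) linarith+
    also have "\<dots> = real n powr (5/7)"
      using n1 powr_diff[of "real n" 1 "2/7"] by simp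
    finally have "real (n div m n + 1) * ln (2 * (real n + 1)) \<le> (real n powr (5/7) + 1) * ln (2 * (real n + 1))"
      by (intro mult_right_mono) auto
    then have "exp (real (n div m n + 1) * ln (2 * (real n + 1))) \<le> exp ((real n powr (5/7) + 1) * ln (2 * (real n + 1)))"
      by simp
    then have expo: "(2 * (real n + 1)) ^ (n div m n + 1) \<le> exp ((real n powr (5/7) + 1) * ln (2 * (real n + 1)))"
      by (simp only: exp_of_nat_mult) simp
    have "Per n (tri_vertex (fst x) (snd x)) \<le> (n + 1) * (3 * ((2 * N + 1) ^ 4 * (2 * (n + 1)) ^ (n div m n + 1)))"
      using Per_le_codes[OF x m1 \<delta> elim(2)] \<eta>_def s1 s2 N_ge unfolding L_def N'_def by blast
    then have "real (Per n (tri_vertex (fst x) (snd x))) \<le>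
        real ((n + 1) * (3 * ((2 * N + 1) ^ 4 * (2 * (n + 1)) ^ (n div m n + 1))))"
      by (rule of_nat_mono)
    also have "\<dots> = 3 * (real n + 1) * (2 * real N + 1) ^ 4 * (2 * (real n + 1)) ^ (n div m n + 1)"
      by (simp only: of_nat_mult of_nat_add of_nat_power of_nat_numeral of_nat_1 mult_ac)
    also have "\<dots> \<le> 3 * (real n + 1) * (K * (real n + 1)\<^sup>2 * exp ((16 * \<mu> + 8) * \<mu> powr (3/2)) + 3) ^ 4
        * exp ((real n powr (5/7) + 1) * ln (2 * (real n + 1)))"
      using power_mono[OF base, of 4] expo K by (intro mult_mono[OF mult_left_mono]) auto
    also have "\<dots> \<le> exp (real n powr 0.73)" using elim(4) unfolding \<mu>_def .
    finally show ?case .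
  qed
qed

text \<open>The finitely many values before the threshold are absorbed into \<open>C\<close>; the
  summand 2 makes the inequality strict.\<close>

lemma bound_from_eventually:
  fixes f :: "nat \<Rightarrow> nat"
  assumes "\<forall>\<^sub>F n in sequentially. real (f n) \<le> exp (real n powr a)" and "a \<le> b"
  shows "\<exists>C>0. \<forall>n\<ge>1. real (f n) < C * exp (real n powr b)"
proof -
  obtain n0 where n0: "\<And>n. n \<ge> n0 \<Longrightarrow> real (f n) \<le> exp (real n powr a)"
    using assms(1) by (auto simp: eventually_sequentially)
  define C where "C = 2 + (\<Sum>i<n0. real (f i))"
  have C: "2 \<le> C" by (simp add: C_def sum_nonneg)
  have "real (f n) < C * exp (real n powr b)" if "n \<ge> 1" for n
  proof (cases "n < n0")
    case True
    have "real (f n) \<le> (\<Sum>i<n0. real (f i))" using True by (intro member_le_sum) auto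
    also have "\<dots> < C * 1" by (simp add: C_def)
    also have "\<dots> \<le> C * exp (real n powr b)" using C by (intro mult_left_mono) auto
    finally show ?thesis .
  next
    case False
    have "real n powr a \<le> real n powr b" using assms(2) that by (intro powr_mono) auto
    then have "real (f n) \<le> 1 * exp (real n powr b)" using n0[of n] False by (simp add: order_trans)
    also have "\<dots> < C * exp (real n powr b)" using C by (intro mult_strict_right_mono) auto
    finally show ?thesis .
  qed
  then show ?thesis using C by (intro exI[of _ C]) auto
qed

theorem theorem4p5:
  shows "AE x in lborel.
           (0 < fst x \<and> 0 < snd x \<and> fst x + snd x < pi) \<longrightarrow>
           (\<forall>\<epsilon>>0. \<exists>C>0. \<forall>n::nat\<ge>1.
              real (Per n (tri_vertex (fst x) (snd x)))
                < C * exp (real n powr (sqrt 3 - 1 + \<epsilon>)))"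
  using generic_collinear
proof (rule AE_mp, intro AE_I2 impI allI)
  fix x :: "real \<times> real" and \<epsilon> :: real
  assume gen: "x \<in> tri_params \<longrightarrow>
     (\<forall>\<^sub>F m in sequentially. \<forall>t\<in>prefix_triples m. vertex_cr x t = 0 \<or> theta m \<le> \<bar>vertex_cr x t\<bar>)"
    and x: "0 < fst x \<and> 0 < snd x \<and> fst x + snd x < pi" and "0 < \<epsilon>"
  \<comment> \<open>The square of 1.73 is 2.9929, so the exponent 0.73 suffices for every positive
    \<open>\<epsilon>\<close>.\<close>
  have "1.73 \<le> sqrt 3" by (rule real_le_rsqrt) (simp add: power2_eq_square)
  then have "0.73 \<le> sqrt 3 - 1 + \<epsilon>" using \<open>0 < \<epsilon>\<close> by simp
  moreover have "x \<in> tri_params" using x by (simp add: tri_params_def)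
  ultimately show "\<exists>C>0. \<forall>n::nat\<ge>1. real (Per n (tri_vertex (fst x) (snd x)))
                < C * exp (real n powr (sqrt 3 - 1 + \<epsilon>))"
    using bound_from_eventually[OF Per_subexponential[OF _ gen[rule_format]]] by blast
qed

end
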